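(* Let $\ell\ge1$ be an integer and $a\in\mathbb C^*$. Then $V(Y_{\ell,a}Y_{0,aq^\ell}^{-1})$ is irreducible as a $\mathcal U_q(\hat{sl}_\infty)$-module and as a $\mathcal U_q^h(\hat{sl}_\infty)$-module.
   Context: Algebra. Fix $t\in\mathbb C$ such that $q=e^{t}$ is not a root of unity, and put $q^{r}=e^{tr}$ for $r\in\mathbb Q$. For $i,j\in\mathbb Z$ let $C_{ii}=2$, $C_{i,i\pm1}=-1$, $C_{ij}=0$ otherwise; $\mathfrak h=\bigoplus_{i\in\mathbb Z}\mathbb Q h_i$; $\Lambda_i\in\mathfrak h^*$ with $\Lambda_i(h_j)=\delta_{ij}$; $\alpha_i=2\Lambda_i-\Lambda_{i-1}-\Lambda_{i+1}$. The algebra $\mathcal U_q(\hat{sl}_\infty)$ is the $\mathbb C$-algebra generated by $x_{i,r}^{\pm}$ ($i,r\in\mathbb Z$), $k_h$ ($h\in\mathfrak h$), $h_{i,m}$ ($i\in\mathbb Z$, $m\in\mathbb Z\setminus\{0\}$). With $x_i^\pm(z)=\sum_{r}x_{i,r}^\pm z^r$, $\phi_i^\pm(z)=\sum_{m\ge0}\phi^\pm_{i,\pm m}z^{\pm m}=k_{\pm h_i}\exp(\pm(q-q^{-1})\sum_{m\ge1}h_{i,\pm m}z^{\pm m})$, $\delta(z)=\sum_{s\in\mathbb Z}z^s$, the relations are: $k_hk_{h'}=k_{h+h'}$, $k_0=1$; all $k_h$ and all coefficients of the $\phi_i^\pm(z)$ commute; $k_hx_j^\pm(z)k_{-h}=q^{\pm\alpha_j(h)}x_j^\pm(z)$;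 for $\epsilon\in\{+,-\}$, $(w-q^{\pm C_{ij}}z)\phi_i^{\epsilon}(z)x_j^\pm(w)=(q^{\pm C_{ij}}w-z)x_j^\pm(w)\phi_i^{\epsilon}(z)$; $[x_i^+(z),x_j^-(w)]=\frac{\delta_{ij}}{q-q^{-1}}\big(\delta(w/z)\phi_i^+(w)-\delta(z/w)\phi_i^-(z)\big)$; $(w-q^{\pm C_{ij}}z)x_i^\pm(z)x_j^\pm(w)=(q^{\pm C_{ij}}w-z)x_j^\pm(w)x_i^\pm(z)$; for $|i-j|=1$, $x_i^\pm(z_1)x_i^\pm(z_2)x_j^\pm(w)-(q+q^{-1})x_i^\pm(z_1)x_j^\pm(w)x_i^\pm(z_2)+x_j^\pm(w)x_i^\pm(z_1)x_i^\pm(z_2)+(z_1\leftrightarrow z_2)=0$; and $[x_i^\pm(z),x_j^\pm(w)]=0$ for $|i-j|\ge2$. $\mathcal U_q^h(\hat{sl}_\infty)$ is the subalgebra generated by all $x_{i,0}^\pm$ ($i\in\mathbb Z$) and $k_h$ ($h\in\mathfrak h$). The module. Put $\psi(z)=\frac{q-q^{-1}z}{1-z}$. Let $\mathcal T_{[1,\ell]}$ be the set of integer sequences $T=(i_1<\cdots<i_\ell)$. $\tilde e_iT$ is obtained by replacing the entry $i+1$ by $i$ ($0$ if $i+1\notin T$ or $i\in T$), $\tilde f_iT$ by replacing $i$ by $i+1$ ($0$ if $i\notin T$ or $i+1\in T$). $V(Y_{\ell,a}Y_{0,aq^\ell}^{-1})$ is the $\mathcal U_q(\hat{sl}_\infty)$-module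 (constructed in the paper as a submodule of the fusion product of the fundamental modules $V(Y_{\ell,a})$ and $V(Y_{0,aq^\ell}^{-1})$) with basis $\{T_a\}_{T\in\mathcal T_{[1,\ell]}}$ and action ($0_a=0$; rational functions expanded in $z^{\pm1}$ for $\phi_i^\pm$): $x_i^+(z)T_a=\sum_{p}\delta_{\{i_p=i+1\}}\delta(aq^{i+\ell+1-2p}z)(\tilde e_iT)_a$; $x_i^-(z)T_a=\sum_{p}\delta_{\{i_p=i\}}\delta(aq^{i+\ell+1-2p}z)(\tilde f_iT)_a$; $\phi_i^\pm(z)T_a=\psi(aq^{i+\ell+3-2p}z)^{-1}T_a$ if $i_p=i+1$ for some $p$ and $i\notin T$; $=\psi(aq^{i+\ell+1-2p}z)T_a$ if $i_p=i$ for some $p$ and $i+1\notin T$; $=T_a$ otherwise. *)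

theory Defs
  imports
    "HOL-Library.Poly_Mapping"
    "HOL-Computational_Algebra.Formal_Power_Series"
    "HOL-Algebra.Generated_Rings"
    "HOL-Algebra.QuotRing"
    "HOL-Algebra.Module"
    "HOL-Algebra.Algebraic_Closure_Type"
begin

section \<open>Left modules over a not necessarily commutative ring\<close>

text \<open>The library locale \<^locale>\<open>module\<close> requires a commutative ring of scalars. The locale
  \<^locale>\<open>submodule\<close> does not, and is used unchanged.\<close>

locale left_module = R?: ring R + M?: abelian_group M
  for R :: "('r, 'c) ring_scheme" (structure)
    and M :: "('r, 'v, 'd) module_scheme" (structure) +
  assumes smult_closed:
      "\<lbrakk>a \<in> carrier R; x \<in> carrier M\<rbrakk> \<Longrightarrow> a \<odot>\<^bsub>M\<^esub> x \<in> carrier M"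
    and smult_l_distr:
      "\<lbrakk>a \<in> carrier R; b \<in> carrier R; x \<in> carrier M\<rbrakk> \<Longrightarrow>
        (a \<oplus>\<^bsub>R\<^esub> b) \<odot>\<^bsub>M\<^esub> x = a \<odot>\<^bsub>M\<^esub> x \<oplus>\<^bsub>M\<^esub> b \<odot>\<^bsub>M\<^esub> x"
    and smult_r_distr:
      "\<lbrakk>a \<in> carrier R; x \<in> carrier M; y \<in> carrier M\<rbrakk> \<Longrightarrow>
        a \<odot>\<^bsub>M\<^esub> (x \<oplus>\<^bsub>M\<^esub> y) = a \<odot>\<^bsub>M\<^esub> x \<oplus>\<^bsub>M\<^esub> a \<odot>\<^bsub>M\<^esub> y"
    and smult_assoc:
      "\<lbrakk>a \<in> carrier R; b \<in> carrier R; x \<in> carrier M\<rbrakk> \<Longrightarrow>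
        (a \<otimes>\<^bsub>R\<^esub> b) \<odot>\<^bsub>M\<^esub> x = a \<odot>\<^bsub>M\<^esub> (b \<odot>\<^bsub>M\<^esub> x)"
    and smult_one: "x \<in> carrier M \<Longrightarrow> \<one>\<^bsub>R\<^esub> \<odot>\<^bsub>M\<^esub> x = x"

definition irreducible_module ::
    "('r, 'c) ring_scheme \<Rightarrow> ('r, 'v, 'd) module_scheme \<Rightarrow> bool" where
  "irreducible_module R M \<longleftrightarrow>
     left_module R M \<and> carrier M \<noteq> {\<zero>\<^bsub>M\<^esub>} \<and>
     (\<forall>N. submodule N R M \<longrightarrow> N = {\<zero>\<^bsub>M\<^esub>} \<or> N = carrier M)"


section \<open>The free algebra on the generators\<close>

datatype sign = Plus | Minus

primrec sgn_int :: "sign \<Rightarrow> int" where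
  "sgn_int Plus = 1"
| "sgn_int Minus = - 1"

text \<open>The space \<open>\<hh>\<close> is the type \<^typ>\<open>int \<Rightarrow>\<^sub>0 rat\<close>, with \<open>h\<^sub>i\<close> the
  unit vector at \<open>i\<close>. \<open>GenX s i r\<close> is \<open>x\<^sup>s\<close> with indices \<open>i, r\<close>.
  \<open>GenH s i n\<close> is \<open>h\<close> with indices \<open>i, s (n + 1)\<close>; the shift is there because
  \<open>m = 0\<close> is not an index of the generators \<open>h\<close>.\<close>

datatype gen = GenX sign int int | GenK "int \<Rightarrow>\<^sub>0 rat" | GenH sign int nat

datatype word = Word (letters: "gen list")

instantiation word :: monoid_add
begin
definition zero_word :: word where "0 = Word []"
definition plus_word :: "word \<Rightarrow> word \<Rightarrow> word" where
  "v + w = Word (letters v @ letters w)"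
instance by standard (simp_all add: zero_word_def plus_word_def)
end

text \<open>With concatenation as addition of words, the convolution product of \<^typ>\<open>word \<Rightarrow>\<^sub>0 complex\<close>
  is that of the free associative unital algebra.\<close>

type_synonym falg = "word \<Rightarrow>\<^sub>0 complex"

definition cst :: "complex \<Rightarrow> falg" where
  "cst c = Poly_Mapping.single 0 c"

definition gen :: "gen \<Rightarrow> falg" where
  "gen g = Poly_Mapping.single (Word [g]) 1"

abbreviation x_gen :: "sign \<Rightarrow> int \<Rightarrow> int \<Rightarrow> falg" where
  "x_gen s i r \<equiv> gen (GenX s i r)"

abbreviation k_gen :: "(int \<Rightarrow>\<^sub>0 rat) \<Rightarrow> falg" where
  "k_gen h \<equiv> gen (GenK h)"

abbreviation free_ring :: "falg ring" where
  "free_ring \<equiv> ring_of_type_algebra"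


section \<open>The algebra \<open>U\<^sub>q\<close> and its horizontal subalgebra\<close>

definition qpow :: "complex \<Rightarrow> rat \<Rightarrow> complex" where
  "qpow t r = exp (t * of_rat r)"

definition Cartan :: "int \<Rightarrow> int \<Rightarrow> int" where
  "Cartan i j = (if i = j then 2 else if \<bar>i - j\<bar> = 1 then - 1 else 0)"

definition Lambda :: "int \<Rightarrow> (int \<Rightarrow>\<^sub>0 rat) \<Rightarrow> rat" where
  "Lambda i h = Poly_Mapping.lookup h i"

definition alpha :: "int \<Rightarrow> (int \<Rightarrow>\<^sub>0 rat) \<Rightarrow> rat" where
  "alpha i h = 2 * Lambda i h - Lambda (i - 1) h - Lambda (i + 1) h"

text \<open>The exponential of a power series over the (noncommutative) free algebra; it is only
  used for series without constant term, so \<open>A ^ n\<close> does not contribute to the coefficient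
  of index \<open>m\<close> when \<open>n > m\<close>.\<close>

definition falg_exp :: "falg fps \<Rightarrow> falg fps" where
  "falg_exp A = Abs_fps (\<lambda>m. \<Sum>n\<le>m. cst (1 / fact n) * fps_nth (A ^ n) m)"

text \<open>\<open>phi_series t s i\<close> is \<open>\<phi>\<^sub>i\<^sup>s(z)\<close> as a power series in \<open>z\<close> (for \<open>s = Plus\<close>)
  or \<open>z\<^sup>-\<^sup>1\<close> (for \<open>s = Minus\<close>); \<open>phi t s i m\<close> is its coefficient at
  \<open>z\<^sup>m\<close>, for \<open>m\<close> of either sign.\<close>

definition phi_series :: "complex \<Rightarrow> sign \<Rightarrow> int \<Rightarrow> falg fps" where
  "phi_series t s i =
     fps_const (k_gen (Poly_Mapping.single i (of_int (sgn_int s)))) *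
     falg_exp (fps_const (cst (of_int (sgn_int s) * (exp t - 1 / exp t))) *
       Abs_fps (\<lambda>m. if m = 0 then 0 else gen (GenH s i (m - 1))))"

definition phi :: "complex \<Rightarrow> sign \<Rightarrow> int \<Rightarrow> int \<Rightarrow> falg" where
  "phi t s i m =
     (if sgn_int s * m \<ge> 0 then fps_nth (phi_series t s i) (nat (sgn_int s * m)) else 0)"

text \<open>Each identity between formal distributions is imposed coefficientwise:
  \<open>phi_x\<close> and \<open>x_x\<close> are the coefficients at \<open>z\<^sup>m w\<^sup>n\<close>; in \<open>xp_xm\<close>, both
  \<open>\<delta>(w/z) \<phi>\<^sup>+(w)\<close> and \<open>\<delta>(z/w) \<phi>\<^sup>-(z)\<close> have at \<open>z\<^sup>m w\<^sup>n\<close> the coefficient of index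
  \<open>m + n\<close> of \<open>\<phi>\<^sup>\<plusminus>\<close>. An element \<open>f - g\<close> of the set stands for the relation \<open>f = g\<close>.\<close>

inductive_set uq_relations :: "complex \<Rightarrow> falg set" for t :: complex where
  k_mult: "k_gen h * k_gen h' - k_gen (h + h') \<in> uq_relations t"
| k_zero: "k_gen 0 - 1 \<in> uq_relations t"
| k_phi: "k_gen h * phi t e i m - phi t e i m * k_gen h \<in> uq_relations t"
| phi_phi: "phi t e i m * phi t e' j n - phi t e' j n * phi t e i m \<in> uq_relations t"
| k_x: "k_gen h * x_gen s j r * k_gen (- h)
        - cst (qpow t (of_int (sgn_int s) * alpha j h)) * x_gen s j r \<in> uq_relations t"
| phi_x: "c = cst (exp t powi (sgn_int s * Cartan i j)) \<Longrightarrow>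
      (phi t e i m * x_gen s j (n - 1) - c * phi t e i (m - 1) * x_gen s j n)
      - (c * x_gen s j (n - 1) * phi t e i m - x_gen s j n * phi t e i (m - 1))
      \<in> uq_relations t"
| xp_xm: "(x_gen Plus i m * x_gen Minus j n - x_gen Minus j n * x_gen Plus i m)
      - (if i = j
         then cst (1 / (exp t - 1 / exp t)) * (phi t Plus i (m + n) - phi t Minus i (m + n))
         else 0) \<in> uq_relations t"
| x_x: "c = cst (exp t powi (sgn_int s * Cartan i j)) \<Longrightarrow>
      (x_gen s i m * x_gen s j (n - 1) - c * x_gen s i (m - 1) * x_gen s j n)
      - (c * x_gen s j (n - 1) * x_gen s i m - x_gen s j n * x_gen s i (m - 1))
      \<in> uq_relations t"
| serre: "\<lbrakk>\<bar>i - j\<bar> = 1;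
      S = (\<lambda>m1 m2. x_gen s i m1 * x_gen s i m2 * x_gen s j n
             - cst (exp t + 1 / exp t) * x_gen s i m1 * x_gen s j n * x_gen s i m2
             + x_gen s j n * x_gen s i m1 * x_gen s i m2)\<rbrakk> \<Longrightarrow>
      S m1 m2 + S m2 m1 \<in> uq_relations t"
| x_commute: "\<bar>i - j\<bar> \<ge> 2 \<Longrightarrow>
      x_gen s i m * x_gen s j n - x_gen s j n * x_gen s i m \<in> uq_relations t"

definition uq_ideal :: "complex \<Rightarrow> falg set" where
  "uq_ideal t = genideal free_ring (uq_relations t)"

definition Uq :: "complex \<Rightarrow> falg set ring" where
  "Uq t = free_ring Quot (uq_ideal t)"

definition uq_class :: "complex \<Rightarrow> falg \<Rightarrow> falg set" where
  "uq_class t f = uq_ideal t +>\<^bsub>free_ring\<^esub> f"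

text \<open>The classes of the constants make the generated subring a complex subalgebra.\<close>

definition Uqh :: "complex \<Rightarrow> falg set ring" where
  "Uqh t = (Uq t) \<lparr>carrier := generate_ring (Uq t)
     (range (\<lambda>c. uq_class t (cst c)) \<union> range (\<lambda>(s, i). uq_class t (x_gen s i 0))
      \<union> range (\<lambda>h. uq_class t (k_gen h)))\<rparr>"


section \<open>The module \<open>V(Y\<^bsub>l,a\<^esub> Y\<^bsub>0,aq^l\<^esub>\<^sup>-\<^sup>1)\<close>\<close>

text \<open>\<^typ>\<open>int list \<Rightarrow>\<^sub>0 complex\<close> is the vector space with one basis vector for each list of
  integers; the basis vectors \<open>T\<^sub>a\<close> of \<open>V\<close> are those of the lists in \<open>tableaux l\<close>. The
  entry \<open>i\<^sub>p\<close> of \<open>T\<close> is \<^term>\<open>T ! (p - 1)\<close>.\<close>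

type_synonym vect = "int list \<Rightarrow>\<^sub>0 complex"

definition tableaux :: "nat \<Rightarrow> int list set" where
  "tableaux l = {T. length T = l \<and> sorted_wrt (<) T}"

definition vscale :: "complex \<Rightarrow> vect \<Rightarrow> vect" where
  "vscale c v = Poly_Mapping.map (\<lambda>b. c * b) v"

definition basis_vec :: "int list \<Rightarrow> vect" where
  "basis_vec T = Poly_Mapping.single T 1"

definition lin_ext :: "(int list \<Rightarrow> vect) \<Rightarrow> vect \<Rightarrow> vect" where
  "lin_ext F v = (\<Sum>T\<in>Poly_Mapping.keys v. vscale (Poly_Mapping.lookup v T) (F T))"

definition e_tilde :: "int \<Rightarrow> int list \<Rightarrow> vect" where
  "e_tilde i T = (if i + 1 \<notin> set T \<or> i \<in> set T then 0
     else basis_vec (map (\<lambda>j. if j = i + 1 then i else j) T))"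

definition f_tilde :: "int \<Rightarrow> int list \<Rightarrow> vect" where
  "f_tilde i T = (if i \<notin> set T \<or> i + 1 \<in> set T then 0
     else basis_vec (map (\<lambda>j. if j = i then i + 1 else j) T))"

text \<open>\<open>psi_series q s u\<close> is the expansion of \<open>\<psi>(u z) = (q - q\<^sup>-\<^sup>1 u z) / (1 - u z)\<close>,
  as a power series in \<open>z\<close> for \<open>s = Plus\<close>, and as one in \<open>z\<^sup>-\<^sup>1\<close> for \<open>s = Minus\<close>
  (numerator and denominator multiplied by \<open>z\<^sup>-\<^sup>1\<close>).\<close>

primrec psi_series :: "complex \<Rightarrow> sign \<Rightarrow> complex \<Rightarrow> complex fps" where
  "psi_series q Plus u =
     (fps_const q - fps_const (u / q) * fps_X) / (1 - fps_const u * fps_X)"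
| "psi_series q Minus u =
     (fps_const q * fps_X - fps_const (u / q)) / (fps_X - fps_const u)"

definition position :: "int list \<Rightarrow> int \<Rightarrow> int" where
  "position T j = (THE p. 1 \<le> p \<and> p \<le> int (length T) \<and> T ! nat (p - 1) = j)"

text \<open>The eigenvalue of \<open>\<phi>\<^sub>i\<^sup>s(z)\<close> on \<open>T\<^sub>a\<close>, as a series in \<open>z\<close> or \<open>z\<^sup>-\<^sup>1\<close>.\<close>

definition phi_eigen ::
    "complex \<Rightarrow> nat \<Rightarrow> complex \<Rightarrow> sign \<Rightarrow> int \<Rightarrow> int list \<Rightarrow> complex fps" where
  "phi_eigen t l a s i T =
     (if i + 1 \<in> set T \<and> i \<notin> set T
      then inverse (psi_series (exp t) s
             (a * exp t powi (i + int l + 3 - 2 * position T (i + 1))))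
      else if i \<in> set T \<and> i + 1 \<notin> set T
      then psi_series (exp t) s (a * exp t powi (i + int l + 1 - 2 * position T i))
      else 1)"

text \<open>The eigenvalue of the generator \<open>h\<close> with indices \<open>i, s (n + 1)\<close>, obtained by solving
  \<open>\<phi>\<^sub>i\<^sup>s = k exp(s (q - q\<^sup>-\<^sup>1) \<Sum> \<dots>)\<close> for the \<open>h\<close>'s: it is \<open>s / (q - q\<^sup>-\<^sup>1)\<close> times the
  coefficient of index \<open>n + 1\<close> of the logarithm of the eigenvalue of \<open>\<phi>\<^sub>i\<^sup>s\<close> divided by its
  constant term. Here \<^term>\<open>fps_ln 1\<close> is the series of \<open>ln (1 + X)\<close>.\<close>

definition h_eigen ::
    "complex \<Rightarrow> nat \<Rightarrow> complex \<Rightarrow> sign \<Rightarrow> int \<Rightarrow> nat \<Rightarrow> int list \<Rightarrow> complex" where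
  "h_eigen t l a s i n T =
     (let F = phi_eigen t l a s i T in
        of_int (sgn_int s) / (exp t - 1 / exp t) *
        fps_nth (fps_compose (fps_ln 1) (fps_const (1 / fps_nth F 0) * F - 1)) (n + 1))"

text \<open>The constant term \<open>k\<close> of \<open>\<phi>\<^sub>i\<^sup>+\<close> at \<open>h\<^sub>i\<close> gives \<open>T\<^sub>a\<close> the weight \<open>\<omega>\<close> with
  \<open>\<omega>(h\<^sub>i) = [i \<in> T] - [i + 1 \<in> T]\<close>; for general \<open>h\<close>, \<open>k\<^sub>h\<close> acts on a vector of
  weight \<open>\<omega>\<close> by \<open>q\<close> to the power \<open>\<omega>(h)\<close>.\<close>

definition weight :: "int list \<Rightarrow> (int \<Rightarrow>\<^sub>0 rat) \<Rightarrow> rat" where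
  "weight T h = (\<Sum>i\<in>Poly_Mapping.keys h.
     Lambda i h * (of_bool (i \<in> set T) - of_bool (i + 1 \<in> set T)))"

text \<open>In the action of \<open>x\<close>, the coefficient at \<open>z\<^sup>r\<close> of \<open>\<delta>(u z)\<close> is \<open>u\<^sup>r\<close>.\<close>

primrec gen_action :: "complex \<Rightarrow> nat \<Rightarrow> complex \<Rightarrow> gen \<Rightarrow> int list \<Rightarrow> vect" where
  "gen_action t l a (GenX s i r) T = (case s of
     Plus \<Rightarrow> (\<Sum>p = 1..l. if T ! (p - 1) = i + 1
       then vscale ((a * exp t powi (i + int l + 1 - 2 * int p)) powi r) (e_tilde i T) else 0)
   | Minus \<Rightarrow> (\<Sum>p = 1..l. if T ! (p - 1) = i
       then vscale ((a * exp t powi (i + int l + 1 - 2 * int p)) powi r) (f_tilde i T) else 0))"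
| "gen_action t l a (GenK h) T = vscale (qpow t (weight T h)) (basis_vec T)"
| "gen_action t l a (GenH s i n) T = vscale (h_eigen t l a s i n T) (basis_vec T)"

definition falg_action :: "complex \<Rightarrow> nat \<Rightarrow> complex \<Rightarrow> falg \<Rightarrow> vect \<Rightarrow> vect" where
  "falg_action t l a f v = (\<Sum>w\<in>Poly_Mapping.keys f.
     vscale (Poly_Mapping.lookup f w)
       (foldr (\<lambda>g. lin_ext (gen_action t l a g)) (letters w) v))"

text \<open>A class in the quotient acts by the common value of its representatives. This value exists
  because the defining relations of \<open>U\<^sub>q\<close> hold on \<open>V\<close>; as \<^const>\<open>irreducible_module\<close>
  includes \<^const>\<open>left_module\<close>, checking them is part of proving irreducibility. The fields
  \<^const>\<open>monoid.mult\<close> and \<^const>\<open>one\<close> of a module record have no meaning.\<close>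

definition V :: "complex \<Rightarrow> nat \<Rightarrow> complex \<Rightarrow> (falg set, vect) module" where
  "V t l a = \<lparr>carrier = {v. Poly_Mapping.keys v \<subseteq> tableaux l},
     monoid.mult = undefined, one = undefined, zero = 0, add = (+),
     module.smult = (\<lambda>A v. the_elem ((\<lambda>f. falg_action t l a f v) ` A))\<rparr>"

end

theory Submission
  imports Defs "HOL-Combinatorics.Transposition"
begin

text \<open>Identify a tableau with its set \<open>S\<close> of entries. The operators \<open>x\<^sub>i\<^sup>\<plusminus>\<close> exchange \<open>i\<close>
  and \<open>i + 1\<close> in \<open>S\<close> and multiply by a power of \<open>u = a q\<^bsup>i + l - 1 - 2 r\<^esup>\<close>, where \<open>r\<close> is the number
  of entries below \<open>i\<close>; such an exchange changes \<open>r\<close> only for the next index \<open>i + 1\<close>, and the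
  eigenvalue of \<open>\<phi>\<^sub>i(z)\<close> is always of the form \<open>(Q - Q\<^sup>-\<^sup>1 u z) / (1 - u z)\<close> with \<open>Q\<close> a power of
  \<open>q\<close>. This reduces the defining relations to identities between such fractions.

  The \<open>k\<^sub>h\<close> separate the basis vectors because \<open>q\<close> is not a root of unity, so a nonzero
  submodule contains a basis vector: take a vector of minimal support. The operators
  \<open>x\<^bsub>i,0\<^esub>\<^sup>\<plusminus>\<close> permute the basis vectors up to zero, and connect any two of them. Only elements of
  the horizontal subalgebra occur, hence both claims.\<close>

section \<open>Linear extension and the action of the free algebra\<close>

lemma lookup_vscale [simp]: "Poly_Mapping.lookup (vscale c v) T = c * Poly_Mapping.lookup v T"
  by (simp add: vscale_def Poly_Mapping.map.rep_eq when_def)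

lemma vscale_add: "vscale c (v + w) = vscale c v + vscale c w"
  by (intro poly_mapping_eqI) (simp add: lookup_add algebra_simps)

lemma vscale_add_left: "vscale (c + d) v = vscale c v + vscale d v"
  by (intro poly_mapping_eqI) (simp add: lookup_add algebra_simps)

lemma vscale_diff_left: "vscale (c - d) v = vscale c v - vscale d v"
  by (intro poly_mapping_eqI) (simp add: lookup_minus algebra_simps)

lemma vscale_vscale [simp]: "vscale c (vscale d v) = vscale (c * d) v"
  by (intro poly_mapping_eqI) (simp add: algebra_simps)

lemma vscale_simps [simp]: "vscale c 0 = 0" "vscale 0 v = 0" "vscale 1 v = v"
  by (auto intro!: poly_mapping_eqI)

lemma vscale_uminus: "vscale (- c) v = - vscale c v" "vscale c (- v) = - vscale c v"
  by (auto intro!: poly_mapping_eqI)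

lemma vscale_sum: "vscale c (sum f A) = (\<Sum>x\<in>A. vscale c (f x))"
  by (induction A rule: infinite_finite_induct) (simp_all add: vscale_add)

lemma keys_vscale_subset: "Poly_Mapping.keys (vscale c v) \<subseteq> Poly_Mapping.keys v"
  by (auto simp: in_keys_iff)

lemma lookup_basis_vec: "Poly_Mapping.lookup (basis_vec T) T' = of_bool (T = T')"
  by (simp add: basis_vec_def lookup_single when_def)

lemma keys_basis_vec [simp]: "Poly_Mapping.keys (basis_vec T) = {T}"
  by (simp add: basis_vec_def)

lemma lin_ext_superset:
  assumes "finite A" "Poly_Mapping.keys v \<subseteq> A"
  shows "lin_ext F v = (\<Sum>T\<in>A. vscale (Poly_Mapping.lookup v T) (F T))"
  unfolding lin_ext_def using assms by (intro sum.mono_neutral_left) (auto simp: in_keys_iff)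

lemma lin_ext_add: "lin_ext F (v + w) = lin_ext F v + lin_ext F w"
proof -
  let ?A = "Poly_Mapping.keys v \<union> Poly_Mapping.keys w"
  have "finite ?A" "Poly_Mapping.keys (v + w) \<subseteq> ?A"
    by (auto simp: in_keys_iff lookup_add)
  then show ?thesis
    by (simp add: lin_ext_superset[of ?A] lookup_add vscale_add_left sum.distrib)
qed

lemma lin_ext_zero [simp]: "lin_ext F 0 = 0"
  by (simp add: lin_ext_def)

lemma lin_ext_vscale: "lin_ext F (vscale c v) = vscale c (lin_ext F v)"
  using keys_vscale_subset[of c v]
  by (simp add: lin_ext_superset[of "Poly_Mapping.keys v"] vscale_sum)

lemma lin_ext_basis_vec [simp]: "lin_ext F (basis_vec T) = F T"
  by (simp add: lin_ext_def lookup_basis_vec)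

lemma basis_expansion:
  "v = (\<Sum>T\<in>Poly_Mapping.keys v. vscale (Poly_Mapping.lookup v T) (basis_vec T))"
proof (rule poly_mapping_eqI)
  fix T
  have "(\<Sum>T'\<in>Poly_Mapping.keys v. Poly_Mapping.lookup v T' * of_bool (T' = T))
        = (\<Sum>T'\<in>Poly_Mapping.keys v. if T' = T then Poly_Mapping.lookup v T' else 0)"
    by (intro sum.cong) auto
  then show "Poly_Mapping.lookup v T =
      Poly_Mapping.lookup
        (\<Sum>T\<in>Poly_Mapping.keys v. vscale (Poly_Mapping.lookup v T) (basis_vec T)) T"
    by (simp add: lookup_sum lookup_basis_vec in_keys_iff)
qed

definition linear_map :: "(vect \<Rightarrow> vect) \<Rightarrow> bool" where
  "linear_map L \<longleftrightarrow> (\<forall>v w. L (v + w) = L v + L w) \<and> (\<forall>c v. L (vscale c v) = vscale c (L v))"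

lemma linear_mapD:
  assumes "linear_map L"
  shows "L (v + w) = L v + L w" "L (vscale c v) = vscale c (L v)" "L 0 = 0"
    "L (sum f A) = (\<Sum>x\<in>A. L (f x))"
proof -
  show "L (v + w) = L v + L w" "L (vscale c v) = vscale c (L v)"
    using assms by (auto simp: linear_map_def)
  show zero: "L 0 = 0"
    using assms unfolding linear_map_def by (metis vscale_simps(2))
  show "L (sum f A) = (\<Sum>x\<in>A. L (f x))"
    using assms zero by (induction A rule: infinite_finite_induct) (auto simp: linear_map_def)
qed

definition word_action :: "complex \<Rightarrow> nat \<Rightarrow> complex \<Rightarrow> word \<Rightarrow> vect \<Rightarrow> vect" where
  "word_action t l a w v = foldr (\<lambda>g. lin_ext (gen_action t l a g)) (letters w) v"

lemma word_action_simps: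
  "word_action t l a 0 v = v"
  "word_action t l a (Word [g]) v = lin_ext (gen_action t l a g) v"
  "word_action t l a (w + w') v = word_action t l a w (word_action t l a w' v)"
  by (simp_all add: word_action_def zero_word_def plus_word_def)

lemma linear_word_action: "linear_map (word_action t l a w)"
proof -
  have "foldr (\<lambda>g. lin_ext (gen_action t l a g)) gs (v + w) =
          foldr (\<lambda>g. lin_ext (gen_action t l a g)) gs v +
          foldr (\<lambda>g. lin_ext (gen_action t l a g)) gs w"
    "foldr (\<lambda>g. lin_ext (gen_action t l a g)) gs (vscale c v) =
          vscale c (foldr (\<lambda>g. lin_ext (gen_action t l a g)) gs v)" for gs v w c
    by (induction gs) (simp_all add: lin_ext_add lin_ext_vscale)
  then show ?thesis
    by (simp add: linear_map_def word_action_def)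
qed

lemma falg_action_superset:
  assumes "finite A" "Poly_Mapping.keys f \<subseteq> A"
  shows "falg_action t l a f v =
    (\<Sum>w\<in>A. vscale (Poly_Mapping.lookup f w) (word_action t l a w v))"
  unfolding falg_action_def word_action_def[symmetric]
  using assms by (intro sum.mono_neutral_left) (auto simp: in_keys_iff)

lemma falg_action_plus:
  "falg_action t l a (f + g) v = falg_action t l a f v + falg_action t l a g v"
proof -
  let ?A = "Poly_Mapping.keys f \<union> Poly_Mapping.keys g"
  have "finite ?A" "Poly_Mapping.keys (f + g) \<subseteq> ?A"
    by (auto simp: in_keys_iff lookup_add)
  then show ?thesis
    by (simp add: falg_action_superset[of ?A] lookup_add vscale_add_left sum.distrib)
qed

lemma falg_action_zero [simp]: "falg_action t l a 0 v = 0"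
  by (simp add: falg_action_def)

lemma falg_action_uminus: "falg_action t l a (- f) v = - falg_action t l a f v"
  using falg_action_plus[of t l a f "- f" v] by (simp add: eq_neg_iff_add_eq_0 add.commute)

lemma falg_action_minus:
  "falg_action t l a (f - g) v = falg_action t l a f v - falg_action t l a g v"
  using falg_action_plus[of t l a f "- g" v] by (simp add: falg_action_uminus)

lemma falg_action_sum: "falg_action t l a (sum f A) v = (\<Sum>x\<in>A. falg_action t l a (f x) v)"
  by (induction A rule: infinite_finite_induct) (simp_all add: falg_action_plus)

lemma falg_action_single:
  "falg_action t l a (Poly_Mapping.single w c) v = vscale c (word_action t l a w v)"
  by (subst falg_action_superset[of "{w}"]) auto

lemma linear_falg_action: "linear_map (falg_action t l a f)"
  unfolding linear_map_def falg_action_def word_action_def[symmetric]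
  by (simp add: linear_mapD[OF linear_word_action] vscale_add sum.distrib vscale_sum mult.commute)

lemmas falg_action_linear = linear_mapD[OF linear_falg_action]

lemma falg_expansion:
  "f = (\<Sum>w\<in>Poly_Mapping.keys f. Poly_Mapping.single w (Poly_Mapping.lookup f w))"
  for f :: falg
proof (rule poly_mapping_eqI)
  fix w
  have "(\<Sum>w'\<in>Poly_Mapping.keys f. Poly_Mapping.lookup f w' when w' = w)
        = (\<Sum>w'\<in>Poly_Mapping.keys f. if w' = w then Poly_Mapping.lookup f w' else 0)"
    by (intro sum.cong) auto
  then show "Poly_Mapping.lookup f w = Poly_Mapping.lookup
      (\<Sum>w\<in>Poly_Mapping.keys f. Poly_Mapping.single w (Poly_Mapping.lookup f w)) w"
    by (simp add: lookup_sum lookup_single in_keys_iff)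
qed

text \<open>On monomials the product concatenates words, which composes their actions; linearity in
  the left and then in the right factor gives the rest. This is what makes the action a
  representation.\<close>

lemma falg_action_times:
  "falg_action t l a (f * g) v = falg_action t l a f (falg_action t l a g v)"
proof -
  have single: "falg_action t l a (Poly_Mapping.single w c * Poly_Mapping.single w' c') v =
      falg_action t l a (Poly_Mapping.single w c)
        (falg_action t l a (Poly_Mapping.single w' c') v)" for w c w' c'
    by (simp add: mult_single falg_action_single word_action_simps
        linear_mapD[OF linear_word_action])
  have left: "falg_action t l a (f * Poly_Mapping.single w' c') v =
      falg_action t l a f (falg_action t l a (Poly_Mapping.single w' c') v)" for w' c'
    by (subst (1 2) falg_expansion[of f])
      (simp add: sum_distrib_right falg_action_sum single)
  show ?thesis
    by (subst (1 2) falg_expansion[of g])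
      (simp add: sum_distrib_left falg_action_sum left falg_action_linear)
qed

lemma falg_action_cst [simp]: "falg_action t l a (cst c) v = vscale c v"
  by (simp add: cst_def falg_action_single word_action_simps)

lemma falg_action_one [simp]: "falg_action t l a 1 v = v"
  by (simp flip: single_one add: falg_action_single word_action_simps)

lemma falg_action_gen:
  "falg_action t l a (gen g) v = lin_ext (gen_action t l a g) v"
  by (simp add: gen_def falg_action_single word_action_simps)

lemmas falg_action_simps =
  falg_action_plus falg_action_minus falg_action_uminus falg_action_times falg_action_linear

section \<open>Tableaux as finite sets of integers\<close>

definition rank :: "int set \<Rightarrow> int \<Rightarrow> nat" where
  "rank S i = card {x \<in> S. x < i}"

text \<open>A total involution, so that a move is undone without side conditions; whether a crystal
  operator gives 0 is recorded separately by \<open>movable\<close>.\<close>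

definition flip :: "int \<Rightarrow> int set \<Rightarrow> int set" where
  "flip i S = transpose i (i + 1) ` S"

definition bvec :: "int set \<Rightarrow> vect" where
  "bvec S = basis_vec (sorted_list_of_set S)"

lemma mem_flip: "x \<in> flip i S \<longleftrightarrow> (if x = i then i + 1 else if x = i + 1 then i else x) \<in> S"
proof -
  have "x \<in> flip i S \<longleftrightarrow> transpose i (i + 1) x \<in> S"
    unfolding flip_def by (rule in_transpose_image_iff)
  then show ?thesis
    by (simp add: transpose_def)
qed

lemma finite_flip [simp]: "finite (flip i S) = finite S"
  unfolding flip_def by (rule finite_image_iff) simp

lemma card_flip [simp]: "card (flip i S) = card S"
  unfolding flip_def by (rule card_image) simp

lemma flip_flip [simp]: "flip i (flip i S) = S"
  by (simp add: flip_def image_comp)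

lemma flip_commute: "\<bar>i - j\<bar> \<ge> 2 \<Longrightarrow> flip i (flip j S) = flip j (flip i S)"
  by (auto simp: set_eq_iff mem_flip abs_if split: if_splits)

lemma rank_Suc: "finite S \<Longrightarrow> rank S (i + 1) = rank S i + of_bool (i \<in> S)"
proof (cases "i \<in> S")
  case True
  assume "finite S"
  have "{x \<in> S. x < i + 1} = insert i {x \<in> S. x < i}"
    using True by auto
  with \<open>finite S\<close> True show ?thesis
    by (simp add: rank_def)
next
  case False
  then have "{x \<in> S. x < i + 1} = {x \<in> S. x < i}"
    by (auto simp: order.order_iff_strict)
  with False show ?thesis
    by (simp add: rank_def)
qed

text \<open>Only \<open>j\<close> and \<open>j + 1\<close> are exchanged, and the bound
  \<open>i\<close> separates them only for \<open>i = j + 1\<close>.\<close>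

lemma rank_flip: "i \<noteq> j + 1 \<Longrightarrow> rank (flip j S) i = rank S i"
proof -
  assume "i \<noteq> j + 1"
  then have "{x \<in> flip j S. x < i} = flip j {x \<in> S. x < i}"
    by (auto simp: mem_flip)
  then show ?thesis
    by (simp add: rank_def)
qed

lemma rank_nth:
  assumes "sorted_wrt (<) T" "k < length T"
  shows "rank (set T) (T ! k) = k"
proof -
  have less: "T ! i < T ! j \<longleftrightarrow> i < j" if "i < length T" "j < length T" for i j
    using assms(1) that by (metis linorder_neqE_nat not_less_iff_gr_or_eq sorted_wrt_iff_nth_less)
  have "{x \<in> set T. x < T ! k} = (!) T ` {..<k}"
    using assms(2) by (auto simp: in_set_conv_nth less) (metis less_trans)
  moreover have "inj_on ((!) T) {..<k}"
    using assms by (intro inj_on_nth) (auto simp: strict_sorted_iff)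
  ultimately show ?thesis
    by (simp add: rank_def card_image)
qed

text \<open>In a strictly increasing list the index of an entry, counted from 0, is the number of
  smaller entries. Positions thus become cardinalities.\<close>

lemma nth_eq_iff_rank:
  assumes "finite S" "k < card S"
  shows "sorted_list_of_set S ! k = j \<longleftrightarrow> j \<in> S \<and> k = rank S j"
proof -
  let ?T = "sorted_list_of_set S"
  have T: "sorted_wrt (<) ?T" "set ?T = S" "length ?T = card S"
    using assms by simp_all
  show ?thesis
  proof
    assume "?T ! k = j"
    then show "j \<in> S \<and> k = rank S j"
      using rank_nth[OF T(1), of k] nth_mem[of k ?T] T assms by auto
  next
    assume j: "j \<in> S \<and> k = rank S j"
    then obtain k' where "k' < length ?T" "?T ! k' = j"
      using T by (metis in_set_conv_nth)
    with rank_nth[OF T(1), of k'] T(2) j show "?T ! k = j"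
      by simp
  qed
qed

lemma rank_less_card: "finite S \<Longrightarrow> j \<in> S \<Longrightarrow> rank S j < card S"
  unfolding rank_def by (intro psubset_card_mono) auto

lemma position_eq_rank:
  assumes "finite S" "j \<in> S"
  shows "position (sorted_list_of_set S) j = int (rank S j) + 1"
  unfolding position_def
proof (rule the_equality)
  show "1 \<le> int (rank S j) + 1 \<and> int (rank S j) + 1 \<le> int (length (sorted_list_of_set S)) \<and>
      sorted_list_of_set S ! nat (int (rank S j) + 1 - 1) = j"
    using assms rank_less_card[OF assms] nth_eq_iff_rank[OF assms(1), of "rank S j" j] by simp
next
  fix p
  assume p: "1 \<le> p \<and> p \<le> int (length (sorted_list_of_set S)) \<and>
      sorted_list_of_set S ! nat (p - 1) = j"
  then have "nat (p - 1) < card S"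
    using assms by (auto simp: nat_less_iff)
  with nth_eq_iff_rank[OF assms(1)] p show "p = int (rank S j) + 1"
    by auto
qed

text \<open>No integer lies between the old and the new value of the moved entry, so the list stays
  strictly increasing, and such a list is determined by its set. The disjunction covers
  \<open>f_tilde\<close> and \<open>e_tilde\<close>.\<close>

lemma map_move_eq_flip:
  assumes "finite S" "(x = i \<and> y = i + 1) \<or> (x = i + 1 \<and> y = i)" "x \<in> S" "y \<notin> S"
  shows "map (\<lambda>j. if j = x then y else j) (sorted_list_of_set S) = sorted_list_of_set (flip i S)"
proof (rule strict_sorted_equal)
  show "sorted_wrt (<) (map (\<lambda>j. if j = x then y else j) (sorted_list_of_set S))"
    unfolding sorted_wrt_map
  proof (rule sorted_wrt_mono_rel)
    show "sorted_wrt (<) (sorted_list_of_set S)"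
      by simp
    fix u v
    assume "u \<in> set (sorted_list_of_set S)" "v \<in> set (sorted_list_of_set S)" "u < v"
    moreover from this have "u \<noteq> y" "v \<noteq> y"
      using assms by auto
    ultimately show "(if u = x then y else u) < (if v = x then y else v)"
      using assms(2) by auto
  qed
  have "(\<lambda>j. if j = x then y else j) ` S = flip i S"
    unfolding flip_def using assms by (intro image_cong) (auto simp: transpose_def)
  then show "set (map (\<lambda>j. if j = x then y else j) (sorted_list_of_set S)) =
      set (sorted_list_of_set (flip i S))"
    using assms(1) by simp
qed simp

lemma tableaux_eq_image: "tableaux l = sorted_list_of_set ` {S. finite S \<and> card S = l}"
proof
  show "tableaux l \<subseteq> sorted_list_of_set ` {S. finite S \<and> card S = l}"
  proof
    fix T assume T: "T \<in> tableaux l"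
    then have "sorted_list_of_set (set T) = T" "card (set T) = l"
      by (auto simp: tableaux_def sorted_list_of_set.idem_if_sorted_distinct strict_sorted_iff
          distinct_card)
    then show "T \<in> sorted_list_of_set ` {S. finite S \<and> card S = l}"
      by (intro image_eqI[of _ _ "set T"]) auto
  qed
qed (auto simp: tableaux_def)

section \<open>The action on basis vectors\<close>

primrec movable :: "sign \<Rightarrow> int \<Rightarrow> int set \<Rightarrow> bool" where
  "movable Plus i S \<longleftrightarrow> i + 1 \<in> S \<and> i \<notin> S"
| "movable Minus i S \<longleftrightarrow> i \<in> S \<and> i + 1 \<notin> S"

text \<open>When exactly one of \<open>i\<close>, \<open>i + 1\<close> lies in the tableau, its position is
  \<open>p = rank S i + 1\<close>, and \<open>spectral t l a i S\<close> is then \<open>a q\<close> to the power \<open>i + l + 1 - 2 p\<close>.\<close>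

definition spectral :: "complex \<Rightarrow> nat \<Rightarrow> complex \<Rightarrow> int \<Rightarrow> int set \<Rightarrow> complex" where
  "spectral t l a i S = a * exp t powi (i + int l - 1 - 2 * int (rank S i))"

lemma gen_action_x:
  assumes "finite S" "card S = l"
  shows "gen_action t l a (GenX s i r) (sorted_list_of_set S) =
    (if movable s i S then vscale (spectral t l a i S powi r) (bvec (flip i S)) else 0)"
proof -
  let ?T = "sorted_list_of_set S"
  \<comment> \<open>The entries are distinct, so at most one \<open>p\<close> contributes: the
    position of \<open>x\<close>, counted from 1.\<close>
  have collapse: "(\<Sum>p = 1..l. if ?T ! (p - 1) = x then F p else 0) =
      (if x \<in> S then F (rank S x + 1) else 0)" for x and F :: "nat \<Rightarrow> vect"
  proof -
    have "(\<Sum>p = 1..l. if ?T ! (p - 1) = x then F p else 0) =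
        (\<Sum>p = 1..l. if p = rank S x + 1 then if x \<in> S then F p else 0 else 0)"
    proof (intro sum.cong refl)
      fix p assume "p \<in> {1..l}"
      then have "p - 1 < card S" "p = rank S x + 1 \<longleftrightarrow> p - 1 = rank S x"
        using assms by auto
      then show "(if ?T ! (p - 1) = x then F p else 0) =
          (if p = rank S x + 1 then if x \<in> S then F p else 0 else 0)"
        using nth_eq_iff_rank[OF assms(1), of "p - 1" x] by simp
    qed
    also have "\<dots> = (if x \<in> S then F (rank S x + 1) else 0)"
      using rank_less_card[OF assms(1), of x] assms(2) by (cases "x \<in> S") (auto simp: sum.delta)
    finally show ?thesis .
  qed
  show ?thesis
  proof (cases s)
    case Plus
    show ?thesis
    proof (cases "movable Plus i S")
      case True
      then have "e_tilde i ?T = bvec (flip i S)"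
        using assms map_move_eq_flip[of S "i + 1" i i] by (simp add: e_tilde_def bvec_def)
      \<comment> \<open>The moved entry is \<open>i + 1\<close>, while \<open>spectral\<close>
        counts the entries below \<open>i\<close>; the counts agree because \<open>i\<close> is not
        in \<open>S\<close>.\<close>
      moreover have "rank S (i + 1) = rank S i"
        using True assms by (simp add: rank_Suc)
      ultimately show ?thesis
        using True Plus
        by (simp only: gen_action.simps sign.case collapse) (simp add: spectral_def algebra_simps)
    next
      case False
      then have "e_tilde i ?T = 0"
        using assms by (auto simp: e_tilde_def)
      then show ?thesis
        using False Plus by (auto simp: if_distrib cong: if_cong)
    qed
  next
    case Minus
    show ?thesis
    proof (cases "movable Minus i S")
      case True
      then have "f_tilde i ?T = bvec (flip i S)"
        using assms map_move_eq_flip[of S i i "i + 1"] by (simp add: f_tilde_def bvec_def)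
      then show ?thesis
        using True Minus
        by (simp only: gen_action.simps sign.case collapse) (simp add: spectral_def algebra_simps)
    next
      case False
      then have "f_tilde i ?T = 0"
        using assms by (auto simp: f_tilde_def)
      then show ?thesis
        using False Minus by (auto simp: if_distrib cong: if_cong)
    qed
  qed
qed

lemma falg_action_x:
  assumes "finite S" "card S = l"
  shows "falg_action t l a (x_gen s i r) (bvec S) =
    (if movable s i S then vscale (spectral t l a i S powi r) (bvec (flip i S)) else 0)"
  using gen_action_x[OF assms] by (simp add: falg_action_gen bvec_def)

definition charge :: "int set \<Rightarrow> int \<Rightarrow> int" where
  "charge S i = of_bool (i \<in> S) - of_bool (i + 1 \<in> S)"

definition set_weight :: "int set \<Rightarrow> (int \<Rightarrow>\<^sub>0 rat) \<Rightarrow> rat" where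
  "set_weight S h = (\<Sum>i\<in>Poly_Mapping.keys h. Lambda i h * of_int (charge S i))"

lemma falg_action_k:
  "finite S \<Longrightarrow> falg_action t l a (k_gen h) (bvec S) = vscale (qpow t (set_weight S h)) (bvec S)"
  by (simp add: falg_action_gen bvec_def weight_def set_weight_def charge_def)

lemma set_weight_superset:
  assumes "finite A" "Poly_Mapping.keys h \<subseteq> A"
  shows "set_weight S h = (\<Sum>i\<in>A. Lambda i h * of_int (charge S i))"
  unfolding set_weight_def
  using assms by (intro sum.mono_neutral_left) (auto simp: in_keys_iff Lambda_def)

lemma set_weight_add: "set_weight S (h + h') = set_weight S h + set_weight S h'"
proof -
  let ?A = "Poly_Mapping.keys h \<union> Poly_Mapping.keys h'"
  have "finite ?A" "Poly_Mapping.keys (h + h') \<subseteq> ?A"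
    by (auto simp: in_keys_iff lookup_add)
  then show ?thesis
    by (simp add: set_weight_superset[of ?A] Lambda_def lookup_add algebra_simps sum.distrib)
qed

lemma set_weight_zero [simp]: "set_weight S 0 = 0"
  by (simp add: set_weight_def)

lemma set_weight_uminus: "set_weight S (- h) = - set_weight S h"
  using set_weight_add[of S h "- h"] by simp

lemma set_weight_single: "set_weight S (Poly_Mapping.single i c) = c * of_int (charge S i)"
  by (simp add: set_weight_superset[of "{i}"] Lambda_def)

text \<open>Since \<open>Cartan i j\<close> is the value of the root \<open>alpha j\<close> on the
  unit vector at \<open>i\<close>, this is the shift of the weight by plus or minus that
  root.\<close>

lemma charge_flip:
  "movable s j S \<Longrightarrow> charge (flip j S) i = charge S i + sgn_int s * Cartan i j"
  by (cases s) (auto simp: charge_def mem_flip Cartan_def)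

lemma set_weight_flip:
  assumes "movable s j S"
  shows "set_weight (flip j S) h = set_weight S h + of_int (sgn_int s) * alpha j h"
proof -
  \<comment> \<open>The three added indices are those where column \<open>j\<close> of the Cartan
    matrix is nonzero.\<close>
  let ?A = "Poly_Mapping.keys h \<union> {j - 1, j, j + 1}"
  have "(\<Sum>i\<in>?A. Lambda i h * of_int (Cartan i j)) =
      (\<Sum>i\<in>{j - 1, j, j + 1}. Lambda i h * of_int (Cartan i j))"
    by (intro sum.mono_neutral_right ballI) (auto simp: Cartan_def abs_if split: if_splits)
  also have "\<dots> = alpha j h"
    by (simp add: alpha_def Cartan_def)
  finally have alpha: "(\<Sum>i\<in>?A. Lambda i h * of_int (Cartan i j)) = alpha j h" .
  have "set_weight (flip j S) h = (\<Sum>i\<in>?A. Lambda i h * of_int (charge (flip j S) i))"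
    by (rule set_weight_superset) auto
  also have "\<dots> = (\<Sum>i\<in>?A. Lambda i h * of_int (charge S i) +
      of_int (sgn_int s) * (Lambda i h * of_int (Cartan i j)))"
    by (simp add: charge_flip[OF assms] algebra_simps)
  also have "\<dots> = (\<Sum>i\<in>?A. Lambda i h * of_int (charge S i)) + of_int (sgn_int s) * alpha j h"
    by (simp only: sum.distrib sum_distrib_left[symmetric] alpha)
  also have "(\<Sum>i\<in>?A. Lambda i h * of_int (charge S i)) = set_weight S h"
    by (rule set_weight_superset[symmetric]) auto
  finally show ?thesis .
qed

section \<open>The action of the Cartan currents\<close>

text \<open>\<open>psi_coeff Q u e m\<close> is the coefficient at \<open>z\<^sup>m\<close>, \<open>m\<close> of either sign, of the
  expansion of \<open>(Q - Q\<^sup>-\<^sup>1 u z) / (1 - u z)\<close> in \<open>z\<close> or \<open>z\<^sup>-\<^sup>1\<close>. With \<open>Q = q, q\<^sup>-\<^sup>1, 1\<close>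
  this covers the three cases of the action of \<open>\<phi>\<^sub>i\<close>, with the same \<open>u\<close>.\<close>

definition psi_coeff :: "complex \<Rightarrow> complex \<Rightarrow> sign \<Rightarrow> int \<Rightarrow> complex" where
  "psi_coeff Q u e m =
    (if m = 0 then Q powi sgn_int e
     else if sgn_int e * m > 0 then of_int (sgn_int e) * (Q - 1 / Q) * u powi m else 0)"

text \<open>Coefficient form of multiplying by the denominator 1 - u z. Both directions of expansion
  give the numerator Q - u z / Q, so one recursion serves both signs.\<close>

lemma psi_coeff_rec:
  assumes "Q \<noteq> 0" "u \<noteq> 0"
  shows "psi_coeff Q u e m - u * psi_coeff Q u e (m - 1) =
    (if m = 0 then Q else if m = 1 then - u / Q else 0)"
proof -
  consider "m < 0" | "m = 0" | "m = 1" | "m > 1"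
    by linarith
  then show ?thesis
    using assms
    by cases (cases e; simp add: psi_coeff_def power_int_diff power_int_minus field_simps)+
qed

lemma psi_series_times:
  assumes "u \<noteq> 0"
  shows "psi_series Q Plus u * (1 - fps_const u * fps_X) = fps_const Q - fps_const (u / Q) * fps_X"
    and "psi_series Q Minus u * (fps_X - fps_const u) = fps_const Q * fps_X - fps_const (u / Q)"
proof -
  have "(1 - fps_const u * fps_X) $ 0 \<noteq> 0" "(fps_X - fps_const u) $ 0 \<noteq> 0"
    using assms by simp_all
  then show "psi_series Q Plus u * (1 - fps_const u * fps_X) = fps_const Q - fps_const (u / Q) * fps_X"
    and "psi_series Q Minus u * (fps_X - fps_const u) = fps_const Q * fps_X - fps_const (u / Q)"
    by (simp_all add: fps_divide_unit mult.assoc inverse_mult_eq_1)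
qed

text \<open>Both series agree after multiplication by the nonzero denominator, and power series over
  a field form a domain.\<close>

lemma psi_series_nth:
  assumes "Q \<noteq> 0" "u \<noteq> 0"
  shows "psi_series Q e u $ n = psi_coeff Q u e (sgn_int e * int n)"
proof -
  let ?A = "Abs_fps (\<lambda>n. psi_coeff Q u e (sgn_int e * int n))"
  have "psi_series Q e u = ?A"
  proof (cases e)
    case Plus
    have "?A * (1 - fps_const u * fps_X) = psi_series Q e u * (1 - fps_const u * fps_X)"
      unfolding Plus psi_series_times[OF assms(2)]
    proof (rule fps_ext)
      fix n
      have *: "(A * (1 - fps_const u * fps_X)) $ n = A $ n - u * (if n = 0 then 0 else A $ (n - 1))"
        for A
        using fps_X_mult_right_nth[of "fps_const u * A" n] by (simp add: algebra_simps)
      show "(Abs_fps (\<lambda>n. psi_coeff Q u Plus (sgn_int Plus * int n)) * (1 - fps_const u * fps_X)) $ n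
          = (fps_const Q - fps_const (u / Q) * fps_X) $ n"
        using psi_coeff_rec[OF assms, of Plus "int n"] unfolding *
        by (cases n) (auto simp: psi_coeff_def)
    qed
    moreover have "1 - fps_const u * fps_X \<noteq> 0"
      by (auto simp: fps_eq_iff intro!: exI[of _ 0])
    ultimately show ?thesis
      by simp
  next
    case Minus
    have "?A * (fps_X - fps_const u) = psi_series Q e u * (fps_X - fps_const u)"
      unfolding Minus psi_series_times[OF assms(2)]
    proof (rule fps_ext)
      fix n
      have *: "(A * (fps_X - fps_const u)) $ n = (if n = 0 then 0 else A $ (n - 1)) - u * A $ n"
        for A
        using fps_X_mult_right_nth[of A n] by (simp add: right_diff_distrib)
      \<comment> \<open>The variable is z^-1 and the denominator has been multiplied by it, so index
        \<open>n\<close> belongs to the power \<open>1 - n\<close> of z in the recursion.\<close>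
      show "(Abs_fps (\<lambda>n. psi_coeff Q u Minus (sgn_int Minus * int n)) * (fps_X - fps_const u)) $ n
          = (fps_const Q * fps_X - fps_const (u / Q)) $ n"
        using psi_coeff_rec[OF assms, of Minus "1 - int n"] unfolding *
        by (cases n) (auto simp: psi_coeff_def minus_diff_commute)
    qed
    moreover have "fps_X - fps_const u \<noteq> 0"
      using assms(2) by (auto simp: fps_eq_iff intro!: exI[of _ 0])
    ultimately show ?thesis
      by simp
  qed
  then show ?thesis
    by simp
qed

lemma psi_series_one: "u \<noteq> 0 \<Longrightarrow> psi_series 1 e u = 1"
  by (cases e; rule fps_ext)
    (simp_all add: psi_series_nth psi_coeff_def del: psi_series.simps)

text \<open>This is \<open>\<psi>(q\<^sup>2 u z)\<^sup>-\<^sup>1 = (q\<^sup>-\<^sup>1 - q u z) / (1 - u z)\<close>.\<close>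

lemma inverse_psi_series:
  assumes "Q \<noteq> 0" "u \<noteq> 0"
  shows "inverse (psi_series Q e (Q\<^sup>2 * u)) = psi_series (1 / Q) e u"
proof (rule fps_inverse_unique)
  have nz: "Q\<^sup>2 * u \<noteq> 0"
    using assms by simp
  show "psi_series Q e (Q\<^sup>2 * u) * psi_series (1 / Q) e u = 1" (is "?A * ?B = 1")
  proof (cases e)
    case Plus
    \<comment> \<open>At the argument Q^2 u z the first numerator is Q times the second denominator,
      and the second numerator is 1/Q times the first denominator; in the product everything
      cancels.\<close>
    let ?D = "1 - fps_const (Q\<^sup>2 * u) * fps_X" and ?E = "1 - fps_const u * fps_X"
    have "?A * ?D = fps_const Q * ?E" "?B * ?E = fps_const (1 / Q) * ?D"
      unfolding Plus psi_series_times[OF nz] psi_series_times[OF assms(2)] using assms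
      by (simp_all add: algebra_simps power2_eq_square fps_eq_iff)
    moreover have "(?A * ?B) * (?D * ?E) = (?A * ?D) * (?B * ?E)"
      by (simp only: ac_simps)
    ultimately have "(?A * ?B) * (?D * ?E) = (fps_const Q * fps_const (1 / Q)) * (?D * ?E)"
      by (simp only: ac_simps)
    also have "fps_const Q * fps_const (1 / Q) = 1"
      using assms by simp
    finally have "(?A * ?B) * (?D * ?E) = 1 * (?D * ?E)" .
    moreover have "?D * ?E \<noteq> 0"
      by (auto simp: fps_eq_iff intro!: exI[of _ 0])
    ultimately show ?thesis
      using mult_right_cancel by blast
  next
    case Minus
    let ?D = "fps_X - fps_const (Q\<^sup>2 * u)" and ?E = "fps_X - fps_const u"
    have "?A * ?D = fps_const Q * ?E" "?B * ?E = fps_const (1 / Q) * ?D"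
      unfolding Minus psi_series_times[OF nz] psi_series_times[OF assms(2)] using assms
      by (simp_all add: algebra_simps power2_eq_square fps_eq_iff)
    moreover have "(?A * ?B) * (?D * ?E) = (?A * ?D) * (?B * ?E)"
      by (simp only: ac_simps)
    ultimately have "(?A * ?B) * (?D * ?E) = (fps_const Q * fps_const (1 / Q)) * (?D * ?E)"
      by (simp only: ac_simps)
    also have "fps_const Q * fps_const (1 / Q) = 1"
      using assms by simp
    finally have "(?A * ?B) * (?D * ?E) = 1 * (?D * ?E)" .
    moreover have "?D * ?E \<noteq> 0"
      using assms by (auto simp: fps_eq_iff intro!: exI[of _ 0])
    ultimately show ?thesis
      using mult_right_cancel by blast
  qed
qed

lemma spectral_nonzero [simp]: "spectral t l a i S \<noteq> 0 \<longleftrightarrow> a \<noteq> 0"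
  by (simp add: spectral_def)

text \<open>The three cases are those of charge 1, -1 and 0. For charge -1 the argument is q^2 times
  \<open>spectral\<close>, which \<open>inverse_psi_series\<close> corrects; for charge 0 the
  fraction with Q = 1 is constant.\<close>

lemma phi_eigen_eq:
  assumes "finite S" "a \<noteq> 0"
  shows "phi_eigen t l a e i (sorted_list_of_set S) =
    psi_series (exp t powi charge S i) e (spectral t l a i S)"
proof -
  have "a * exp t powi (i + int l + 3 - 2 * (int (rank S i) + 1)) =
      (exp t)\<^sup>2 * spectral t l a i S"
    by (simp add: spectral_def power_int_diff power_int_add power2_eq_square field_simps)
  moreover have "a * exp t powi (i + int l + 1 - 2 * (int (rank S i) + 1)) =
      spectral t l a i S"
    by (simp add: spectral_def algebra_simps)
  ultimately show ?thesis
    using assms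
    by (cases "i \<in> S"; cases "i + 1 \<in> S")
      (simp_all add: phi_eigen_def charge_def psi_series_one position_eq_rank rank_Suc
        inverse_psi_series power_int_minus divide_inverse del: psi_series.simps)
qed

section \<open>Eigenvalues of power series in the Cartan generators\<close>

definition eigen :: "complex \<Rightarrow> nat \<Rightarrow> complex \<Rightarrow> int set \<Rightarrow> falg \<Rightarrow> complex \<Rightarrow> bool" where
  "eigen t l a S f c \<longleftrightarrow> falg_action t l a f (bvec S) = vscale c (bvec S)"

text \<open>On a common eigenvector eigenvalues add and multiply, so series over the noncommutative
  free algebra can be evaluated as complex power series.\<close>

lemma eigen_intros:
  "eigen t l a S (cst c) c"
  "eigen t l a S 1 1"
  "eigen t l a S 0 0"
  "eigen t l a S f c \<Longrightarrow> eigen t l a S g d \<Longrightarrow> eigen t l a S (f + g) (c + d)"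
  "eigen t l a S f c \<Longrightarrow> eigen t l a S g d \<Longrightarrow> eigen t l a S (f - g) (c - d)"
  "eigen t l a S f c \<Longrightarrow> eigen t l a S g d \<Longrightarrow> eigen t l a S (f * g) (c * d)"
  by (simp_all add: eigen_def falg_action_simps vscale_add_left vscale_diff_left mult.commute)

lemma eigen_sum:
  "(\<And>x. x \<in> A \<Longrightarrow> eigen t l a S (f x) (c x)) \<Longrightarrow> eigen t l a S (sum f A) (sum c A)"
  by (induction A rule: infinite_finite_induct) (auto intro: eigen_intros)

definition eigen_series :: "complex \<Rightarrow> nat \<Rightarrow> complex \<Rightarrow> int set \<Rightarrow> falg fps \<Rightarrow> complex fps \<Rightarrow> bool" where
  "eigen_series t l a S A C \<longleftrightarrow> (\<forall>n. eigen t l a S (A $ n) (C $ n))"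

lemma eigen_series_const:
  "eigen t l a S f c \<Longrightarrow> eigen_series t l a S (fps_const f) (fps_const c)"
  by (auto simp: eigen_series_def intro: eigen_intros)

lemma eigen_series_mult:
  "eigen_series t l a S A C \<Longrightarrow> eigen_series t l a S B D \<Longrightarrow> eigen_series t l a S (A * B) (C * D)"
  by (auto simp: eigen_series_def fps_mult_nth intro!: eigen_intros eigen_sum)

lemma eigen_series_power:
  "eigen_series t l a S A C \<Longrightarrow> eigen_series t l a S (A ^ n) (C ^ n)"
  by (induction n)
    (auto intro: eigen_series_mult eigen_series_const[where f = 1 and c = 1, simplified] eigen_intros)

text \<open>The truncated sum in \<open>falg_exp\<close> has the shape of the coefficient formula
  for composition with the exponential series, so the two match term by term.\<close>

lemma eigen_series_exp:
  assumes "eigen_series t l a S A C"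
  shows "eigen_series t l a S (falg_exp A) (fps_exp 1 oo C)"
proof -
  have "fps_exp 1 oo C = Abs_fps (\<lambda>m. \<Sum>n\<le>m. 1 / fact n * (C ^ n) $ m)"
    by (rule fps_ext) (simp add: fps_compose_nth atLeast0AtMost)
  then show ?thesis
    using eigen_series_power[OF assms]
    by (simp add: eigen_series_def falg_exp_def del: times_divide_eq_left)
      (intro allI eigen_sum eigen_intros, simp)
qed

text \<open>The series exp(X) - 1 and ln(1 + X) are inverse under composition; \<open>G\<close> may
  be substituted because it has no constant term.\<close>

lemma fps_exp_compose_ln:
  assumes "G $ 0 = 0"
  shows "fps_exp (1 :: 'a :: field_char_0) oo (fps_ln 1 oo G) = 1 + G"
proof -
  have "(fps_exp (1 :: 'a) - 1) oo fps_ln 1 = fps_X"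
    by (simp add: fps_ln_fps_exp_inv fps_inv_fps_exp_compose)
  then have "fps_exp (1 :: 'a) oo fps_ln 1 = 1 + fps_X"
    by (simp add: fps_compose_sub_distrib algebra_simps)
  then have "(fps_exp (1 :: 'a) oo fps_ln 1) oo G = 1 + G"
    using assms by (simp add: fps_compose_add_distrib)
  then show ?thesis
    using assms by (simp add: fps_compose_assoc)
qed

lemma eigen_k:
  "finite S \<Longrightarrow> eigen t l a S (k_gen h) (qpow t (set_weight S h))"
  by (simp only: eigen_def falg_action_k)

lemma eigen_h:
  "finite S \<Longrightarrow> eigen t l a S (gen (GenH e i n)) (h_eigen t l a e i n (sorted_list_of_set S))"
  by (simp add: eigen_def falg_action_gen bvec_def)

lemma qpow_of_int: "qpow t (of_int n) = exp t powi n"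
  by (simp add: qpow_def exp_power_int mult.commute)

text \<open>Up to the factor in \<open>c\<close>, the eigenvalues of the \<open>h\<close> generators
  are the coefficients of the logarithm of the wanted series divided by its constant term.
  Exponentiating returns the quotient, and \<open>k\<close> supplies the constant term.\<close>

lemma eigen_phi_series:
  assumes "finite S" "a \<noteq> 0" "(exp t)\<^sup>2 \<noteq> 1"
  shows "eigen_series t l a S (phi_series t e i)
    (psi_series (exp t powi charge S i) e (spectral t l a i S))"
proof -
  define F where "F = phi_eigen t l a e i (sorted_list_of_set S)"
  define c where "c = of_int (sgn_int e) * (exp t - 1 / exp t)"
  define H where "H = Abs_fps (\<lambda>m. if m = 0 then 0 else h_eigen t l a e i (m - 1) (sorted_list_of_set S))"
  have F_psi: "F = psi_series (exp t powi charge S i) e (spectral t l a i S)"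
    unfolding F_def using assms(1,2) by (rule phi_eigen_eq)
  have F0: "F $ 0 = qpow t (set_weight S (Poly_Mapping.single i (of_int (sgn_int e))))"
    using assms(2) by (simp add: F_psi psi_series_nth psi_coeff_def set_weight_single qpow_of_int
        mult.commute del: psi_series.simps flip: of_int_mult power_int_mult)
  then have F0_nz: "F $ 0 \<noteq> 0"
    by (simp add: qpow_def)
  \<comment> \<open>The sign squares to 1, and q - 1/q is invertible because q^2 is not 1.\<close>
  have c: "of_int (sgn_int e) / (exp t - 1 / exp t) * c = 1"
    using assms(3) by (cases e) (auto simp: c_def field_simps power2_eq_square)
  have "fps_const c * H = fps_ln 1 oo (fps_const (1 / F $ 0) * F - 1)"
  proof (rule fps_ext)
    fix n
    show "(fps_const c * H) $ n = (fps_ln 1 oo (fps_const (1 / F $ 0) * F - 1)) $ n"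
    proof (cases n)
      case (Suc k)
      have "c * (of_int (sgn_int e) / (exp t - 1 / exp t) * x) = x" for x
        using c by (metis mult.assoc mult.commute mult_1)
      then show ?thesis
        by (simp only: Suc H_def h_eigen_def F_def[symmetric] Let_def fps_mult_left_const_nth
            fps_nth_Abs_fps) simp
    qed (simp add: H_def)
  qed
  then have "fps_exp 1 oo (fps_const c * H) = fps_const (1 / F $ 0) * F"
    using F0_nz by (simp only: fps_exp_compose_ln) (simp add: fps_exp_compose_ln)
  then have "fps_const (F $ 0) * (fps_exp 1 oo (fps_const c * H)) = F"
    using F0_nz by (simp only: fps_eq_iff) simp
  moreover have "eigen_series t l a S (phi_series t e i)
      (fps_const (F $ 0) * (fps_exp 1 oo (fps_const c * H)))"
    unfolding phi_series_def F0 c_def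
    by (intro eigen_series_mult eigen_series_exp eigen_series_const eigen_k eigen_intros assms)
      (auto simp: eigen_series_def H_def intro!: eigen_intros eigen_h assms)
  ultimately show ?thesis
    by (simp only: F_psi)
qed

lemma eigen_phi:
  assumes "finite S" "a \<noteq> 0" "(exp t)\<^sup>2 \<noteq> 1"
  shows "eigen t l a S (phi t e i m) (psi_coeff (exp t powi charge S i) (spectral t l a i S) e m)"
proof (cases "sgn_int e * m \<ge> 0")
  case True
  then have "sgn_int e * int (nat (sgn_int e * m)) = m"
    by (cases e) auto
  moreover have "eigen t l a S (phi_series t e i $ n)
      (psi_coeff (exp t powi charge S i) (spectral t l a i S) e (sgn_int e * int n))" for n
    using eigen_phi_series[OF assms, of l e i] assms(2)
    by (simp add: eigen_series_def psi_series_nth del: psi_series.simps)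
  ultimately show ?thesis
    using True by (metis (no_types) phi_def)
next
  case False
  then show ?thesis
    by (auto simp: phi_def psi_coeff_def intro: eigen_intros)
qed

section \<open>The defining relations hold on the module\<close>

text \<open>The two expansions of a fraction with a simple pole differ by a multiple of delta(u z).
  This produces the right-hand side of the commutator relation.\<close>

lemma psi_coeff_diff:
  "psi_coeff Q u Plus m - psi_coeff Q u Minus m = (Q - 1 / Q) * u powi m"
  by (simp add: psi_coeff_def power_int_minus divide_inverse algebra_simps)

lemma psi_coeff_1: "psi_coeff 1 u e m = of_bool (m = 0)"
  by (simp add: psi_coeff_def)

text \<open>Both sides are coefficients of (1 - q^2 u z)(q - u z / q) / (1 - u z), since q^2 - u z =
  q (q - u z / q) and 1/q - q u z = (1 - q^2 u z) / q. It serves the relation between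
  \<open>phi\<close> and \<open>x\<close> at equal indices.\<close>

lemma psi_coeff_inverse_rel:
  assumes "q \<noteq> 0" "u \<noteq> 0"
  shows "psi_coeff q u e m - q\<^sup>2 * u * psi_coeff q u e (m - 1) =
    q\<^sup>2 * psi_coeff (1 / q) u e m - u * psi_coeff (1 / q) u e (m - 1)"
proof -
  \<comment> \<open>With the letters \<open>x\<close> for the power and \<open>r\<close> for 1/q,
    tied by \<open>q * r = 1\<close>, each case becomes a polynomial identity.\<close>
  define x where "x = u powi (m - 1)"
  have x: "u powi m = u * x" "x = u powi (m - 1)"
    using assms by (simp_all add: x_def power_int_diff)
  have x0: "m = 0 \<Longrightarrow> u * x = 1" and x1: "m = 1 \<Longrightarrow> x = 1"
    using x by auto
  define r where "r = 1 / q"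
  have r: "q * r = 1" "1 / q = r" "1 / r = q" "inverse q = r" "inverse r = q"
    using assms(1) by (simp_all add: r_def power_int_minus inverse_eq_divide)
  consider "m < 0" | "m = 0" | "m = 1" | "m > 1"
    by linarith
  then show ?thesis
  proof cases
    case 2
    show ?thesis
      unfolding psi_coeff_def x(1) x(2)[symmetric] r(2,3)
      using r(1) x0[OF 2]
      by (cases e; simp add: 2 r(4,5) mult.assoc; simp add: algebra_simps power2_eq_square)
  next
    case 3
    show ?thesis
      unfolding psi_coeff_def x(1) x(2)[symmetric] r(2,3)
      using r(1) x1[OF 3]
      by (cases e; simp add: 3 r(4,5) mult.assoc; simp add: algebra_simps power2_eq_square)
  qed (unfold psi_coeff_def x(1) x(2)[symmetric] r(2,3), insert r(1),
      (cases e; simp; simp add: algebra_simps power2_eq_square)+)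
qed

section \<open>Compatibility of successive moves\<close>

lemma movable_flip_far:
  "\<bar>i - j\<bar> \<ge> 2 \<Longrightarrow> movable s i (flip j S) = movable s i S"
  by (cases s) (auto simp: mem_flip)

lemma not_movable_flip_same: "movable s i S \<Longrightarrow> \<not> movable s i (flip i S)"
  by (cases s) (auto simp: mem_flip)

lemma movable_flip_opposite:
  "movable Plus i S \<Longrightarrow> movable Minus i (flip i S)"
  "movable Minus i S \<Longrightarrow> movable Plus i (flip i S)"
  by (auto simp: mem_flip)

text \<open>The \<open>Minus\<close> move at \<open>j\<close> empties \<open>j\<close> and fills
  \<open>j + 1\<close>, whereas the \<open>Plus\<close> move at \<open>i\<close> needs
  \<open>i\<close> free and \<open>i + 1\<close> occupied; this excludes both neighbours of
  \<open>j\<close>. Distant moves involve disjoint pairs of values.\<close>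

lemma movable_opposite_flip:
  assumes "i \<noteq> j"
  shows "movable Minus j S \<and> movable Plus i (flip j S) \<longleftrightarrow>
    movable Plus i S \<and> movable Minus j (flip i S)"
    and "movable Minus j S \<and> movable Plus i (flip j S) \<Longrightarrow> \<bar>i - j\<bar> \<ge> 2"
  using assms by (auto simp: mem_flip split: if_splits)

text \<open>After the two moves \<open>i\<close> and \<open>i + 1\<close> are both occupied or both
  free. Together with the vanishing of repeated moves, this kills every term of the Serre relation
  separately.\<close>

lemma not_movable_serre:
  "\<bar>i - j\<bar> = 1 \<Longrightarrow> movable s i S \<Longrightarrow> movable s j (flip i S) \<Longrightarrow> \<not> movable s i (flip j (flip i S))"
  by (cases s) (auto simp: mem_flip split: if_splits)

lemma spectral_flip: "i \<noteq> j + 1 \<Longrightarrow> spectral t l a i (flip j S) = spectral t l a i S"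
  by (simp add: spectral_def rank_flip)

lemma spectral_succ:
  "finite S \<Longrightarrow> spectral t l a (i + 1) S =
    (if i \<in> S then spectral t l a i S / exp t else exp t * spectral t l a i S)"
  unfolding spectral_def rank_Suc
  by (simp add: power_int_diff power_int_add power_int_mult power2_eq_square)

lemma spectral_flip_succ:
  "finite S \<Longrightarrow> spectral t l a (j + 1) (flip j S) =
    (if j + 1 \<in> S then spectral t l a j S / exp t else exp t * spectral t l a j S)"
  by (simp add: spectral_succ spectral_flip mem_flip)

text \<open>The exponent changes by 1 or -1 between neighbouring indices, and the two moves decide
  which. Consequently the delta functions of x_i(z) x_j(w) are supported on the zeros of the factor
  in front of this product in the quadratic relation.\<close>

lemma spectral_adjacent:
  assumes "finite S" "movable s j S" "movable s i (flip j S)" "\<bar>i - j\<bar> = 1"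
  shows "spectral t l a j S = exp t powi sgn_int s * spectral t l a i (flip j S)"
proof -
  consider "i = j + 1" | "j = i + 1"
    using assms(4) by linarith
  then show ?thesis
  proof cases
    case 1
    then show ?thesis
      using assms by (cases s) (auto simp: spectral_flip_succ mem_flip power_int_minus simp flip: mult.assoc)
  next
    case 2
    then show ?thesis
      using assms
      by (cases s) (auto simp: spectral_succ spectral_flip mem_flip power_int_minus inverse_eq_divide)
  qed
qed

section \<open>Exchange of Cartan currents with the moves\<close>

definition phi_val :: "complex \<Rightarrow> nat \<Rightarrow> complex \<Rightarrow> sign \<Rightarrow> int \<Rightarrow> int \<Rightarrow> int set \<Rightarrow> complex" where
  "phi_val t l a e i m S = psi_coeff (exp t powi charge S i) (spectral t l a i S) e m"

text \<open>The fraction is (1/q - w z) / (1 - w z / q), and the prefactor cancels its denominator.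
  In \<open>psi_coeff_step_up\<close> the cancellation is 1/q - w z = (1 - q w z) / q.\<close>

lemma psi_coeff_step_down:
  assumes "q \<noteq> 0" "w \<noteq> 0"
  shows "psi_coeff (1 / q) (w / q) e m - 1 / q * w * psi_coeff (1 / q) (w / q) e (m - 1) =
    1 / q * psi_coeff 1 u e m - w * psi_coeff 1 u e (m - 1)"
  using psi_coeff_rec[of "1 / q" "w / q" e m] assms by (auto simp: psi_coeff_1)

lemma psi_coeff_step_up:
  assumes "q \<noteq> 0" "w \<noteq> 0"
  shows "psi_coeff 1 u e m - 1 / q * w * psi_coeff 1 u e (m - 1) =
    1 / q * psi_coeff q (q * w) e m - w * psi_coeff q (q * w) e (m - 1)"
proof -
  have "1 / q * psi_coeff q (q * w) e m - w * psi_coeff q (q * w) e (m - 1) =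
      1 / q * (psi_coeff q (q * w) e m - q * w * psi_coeff q (q * w) e (m - 1))"
    using assms by (simp add: right_diff_distrib)
  also have "\<dots> = psi_coeff 1 u e m - 1 / q * w * psi_coeff 1 u e (m - 1)"
    using assms by (subst psi_coeff_rec) (auto simp: psi_coeff_1)
  finally show ?thesis ..
qed

text \<open>The delta function of x_j fixes its variable to be 1/w. What remains of the relation is
  (1 - c w z) phi' = (c - w z) phi for the eigenvalues phi before and phi' after the move, taken at
  z^m.\<close>

lemma phi_val_flip_Plus:
  fixes t a :: complex and i j :: int and l :: nat
  assumes "finite S" "a \<noteq> 0" "movable Plus j S"
  defines "c \<equiv> exp t powi Cartan i j" and "w \<equiv> spectral t l a j S"
  shows "phi_val t l a e i m (flip j S) - c * w * phi_val t l a e i (m - 1) (flip j S) =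
    c * phi_val t l a e i m S - w * phi_val t l a e i (m - 1) S"
proof -
  let ?q = "exp t"
  have w: "w \<noteq> 0"
    using assms by simp
  consider "i = j" | "i = j + 1" | "j = i + 1" | "\<bar>i - j\<bar> \<ge> 2"
    by linarith
  then show ?thesis
  proof cases
    case 1
    have "charge S j = - 1" "charge (flip j S) j = 1"
      using assms by (auto simp: charge_def mem_flip)
    then show ?thesis
      using psi_coeff_inverse_rel[of ?q w e m] w 1
      by (simp add: phi_val_def spectral_flip c_def w_def Cartan_def power_int_minus divide_inverse)
  next
    case 2
    \<comment> \<open>Only for this \<open>i\<close> does the move change the number of entries
      below \<open>i\<close>, so the spectral parameter differs before and after it.\<close>
    have u: "spectral t l a i S = ?q * w" "spectral t l a i (flip j S) = w / ?q"
      unfolding 2 w_def spectral_succ[OF assms(1)] spectral_flip_succ[OF assms(1)]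
      using assms(3) by simp_all
    have c: "c = 1 / ?q"
      using 2 by (simp add: c_def Cartan_def power_int_minus divide_inverse)
    show ?thesis
    proof (cases "i + 1 \<in> S")
      case True
      then have "charge S i = 0" "charge (flip j S) i = - 1"
        using assms(3) 2 by (auto simp: charge_def mem_flip)
      then show ?thesis
        using psi_coeff_step_down[of ?q w e m] w
        by (simp add: phi_val_def c u power_int_minus inverse_eq_divide)
    next
      case False
      then have "charge S i = 1" "charge (flip j S) i = 0"
        using assms(3) 2 by (auto simp: charge_def mem_flip)
      then show ?thesis
        using psi_coeff_step_up[of ?q w _ e m] w
        by (simp add: phi_val_def c u)
    qed
  next
    case 3
    have u: "spectral t l a i (flip j S) = spectral t l a i S"
      using 3 by (simp add: spectral_flip)
    have c: "c = 1 / ?q"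
      using 3 by (simp add: c_def Cartan_def power_int_minus divide_inverse)
    show ?thesis
    proof (cases "i \<in> S")
      case True
      then have "charge S i = 1" "charge (flip j S) i = 0" "spectral t l a i S = ?q * w"
        using assms(1,3) 3 by (auto simp: charge_def mem_flip w_def spectral_succ)
      then show ?thesis
        using psi_coeff_step_up[of ?q w _ e m] w
        by (simp add: phi_val_def c u)
    next
      case False
      then have "charge S i = 0" "charge (flip j S) i = - 1" "spectral t l a i S = w / ?q"
        using assms(1,3) 3 by (auto simp: charge_def mem_flip w_def spectral_succ)
      then show ?thesis
        using psi_coeff_step_down[of ?q w e m] w
        by (simp add: phi_val_def c u power_int_minus inverse_eq_divide)
    qed
  next
    case 4
    then have "c = 1" "spectral t l a i (flip j S) = spectral t l a i S"
        "charge (flip j S) i = charge S i"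
      by (auto simp: c_def Cartan_def spectral_flip charge_def mem_flip)
    then show ?thesis
      by (simp add: phi_val_def)
  qed
qed

text \<open>A \<open>Minus\<close> move reverses a \<open>Plus\<close> move with the same spectral
  parameter; multiplying the \<open>Plus\<close> relation by the inverse of its constant gives the
  \<open>Minus\<close> relation.\<close>

lemma phi_val_flip:
  fixes t a :: complex and i j :: int and l :: nat
  assumes "finite S" "a \<noteq> 0" "movable s j S"
  defines "c \<equiv> exp t powi (sgn_int s * Cartan i j)" and "w \<equiv> spectral t l a j S"
  shows "phi_val t l a e i m (flip j S) - c * w * phi_val t l a e i (m - 1) (flip j S) =
    c * phi_val t l a e i m S - w * phi_val t l a e i (m - 1) S"
proof (cases s)
  case Plus
  then show ?thesis
    using phi_val_flip_Plus assms by simp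
next
  case Minus
  have "movable Plus j (flip j S)"
    using assms(3) Minus by (simp add: mem_flip)
  moreover have "spectral t l a j (flip j S) = w"
    by (simp add: w_def spectral_flip)
  ultimately have rel: "phi_val t l a e i m S - exp t powi Cartan i j * w * phi_val t l a e i (m - 1) S =
      exp t powi Cartan i j * phi_val t l a e i m (flip j S) - w * phi_val t l a e i (m - 1) (flip j S)"
    using phi_val_flip_Plus[where S = "flip j S" and a = a and t = t and i = i and j = j and l = l
      and e = e and m = m] assms(1,2) by simp
  have c: "c * (exp t powi Cartan i j * x) = x" for x
    using Minus by (simp add: c_def power_int_minus)
  show ?thesis
    using arg_cong[OF rel, of "(*) c"] by (simp add: right_diff_distrib mult.assoc c)
qed

lemma falg_action_phi:
  assumes "finite S" "a \<noteq> 0" "(exp t)\<^sup>2 \<noteq> 1"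
  shows "falg_action t l a (phi t e i m) (bvec S) = vscale (phi_val t l a e i m S) (bvec S)"
  using eigen_phi[OF assms] by (simp add: eigen_def phi_val_def)

lemma power_int_pred: "w \<noteq> 0 \<Longrightarrow> w powi n = w powi (n - 1) * (w :: complex)"
  by (simp add: power_int_diff)

lemma qpow_add: "qpow t (r + s) = qpow t r * qpow t s"
  by (simp add: qpow_def of_rat_add distrib_left exp_add)

lemma relation_annihilates:
  assumes S: "finite S" "card S = l" and a: "a \<noteq> 0" and q: "(exp t)\<^sup>2 \<noteq> 1"
    and f: "f \<in> uq_relations t"
  shows "falg_action t l a f (bvec S) = 0"
proof -
  note act = falg_action_simps falg_action_x falg_action_k falg_action_phi[OF _ a q] S
  have nz: "spectral t l a i S \<noteq> 0" for i S
    using a by simp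
  from f show ?thesis
  proof cases
    case (k_mult h h')
    then show ?thesis
      by (simp add: act set_weight_add qpow_add mult.commute)
  next
    case k_zero
    then show ?thesis
      by (simp add: act) (simp add: qpow_def)
  next
    case (k_phi h e i m)
    then show ?thesis
      by (simp add: act mult.commute)
  next
    case (phi_phi e i m e' j n)
    then show ?thesis
      by (simp add: act mult.commute)
  next
    case (k_x h s j r)
    then show ?thesis
      by (simp add: act set_weight_flip set_weight_uminus)
        (simp add: qpow_def exp_add[symmetric] of_rat_add of_rat_minus of_rat_mult algebra_simps)
  next
    case (phi_x c s i j e m n)
    show ?thesis
    proof (cases "movable s j S")
      case True
      let ?w = "spectral t l a j S"
      let ?c = "exp t powi (sgn_int s * Cartan i j)"
      \<comment> \<open>Taking out the common power of \<open>?w\<close> leaves the difference of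
        the two sides of \<open>phi_val_flip\<close>.\<close>
      have "falg_action t l a f (bvec S) =
         vscale (?w powi (n - 1) *
          ((phi_val t l a e i m (flip j S) - ?c * ?w * phi_val t l a e i (m - 1) (flip j S))
          - (?c * phi_val t l a e i m S - ?w * phi_val t l a e i (m - 1) S))) (bvec (flip j S))"
        using True
        by (simp add: phi_x act flip: vscale_diff_left)
          (simp add: power_int_pred[OF nz, where n = n] algebra_simps)
      then show ?thesis
        using phi_val_flip[OF S(1) a True] by simp
    next
      case False
      then show ?thesis
        by (simp add: phi_x act)
    qed
  next
    case (xp_xm i m j n)
    show ?thesis
    proof (cases "i = j")
      case True
      let ?w = "spectral t l a i S" and ?d = "exp t - 1 / exp t"
      have "?d \<noteq> 0"
        using q by (auto simp: field_simps power2_eq_square)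
      have "falg_action t l a (cst (1 / ?d) * (phi t Plus i (m + n) - phi t Minus i (m + n))) (bvec S) =
          vscale (1 / ?d)
            (vscale (phi_val t l a Plus i (m + n) S - phi_val t l a Minus i (m + n) S) (bvec S))"
        by (simp only: act falg_action_cst vscale_diff_left)
      also have "\<dots> = vscale ((exp t powi charge S i - 1 / exp t powi charge S i) / ?d *
          (?w powi m * ?w powi n)) (bvec S)"
        unfolding phi_val_def psi_coeff_diff using nz by (simp add: power_int_add)
      finally have phi_part:
        "falg_action t l a (cst (1 / ?d) * (phi t Plus i (m + n) - phi t Minus i (m + n))) (bvec S) =
          vscale ((exp t powi charge S i - 1 / exp t powi charge S i) / ?d *
            (?w powi m * ?w powi n)) (bvec S)" .
      \<comment> \<open>For a charge c in {-1, 0, 1} the quotient (q^c - q^-c) / (q - 1/q) equals c.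
        For nonzero c exactly one of the two products survives, moving an entry there and
        back.\<close>
      consider "movable Plus i S" | "movable Minus i S" | "\<not> movable Plus i S" "\<not> movable Minus i S"
        by blast
      then have "falg_action t l a
          (x_gen Plus i m * x_gen Minus i n - x_gen Minus i n * x_gen Plus i m) (bvec S) =
          vscale ((exp t powi charge S i - 1 / exp t powi charge S i) / ?d *
            (?w powi m * ?w powi n)) (bvec S)"
      proof cases
        case 1
        then have "charge S i = - 1" "\<not> movable Minus i S"
          by (auto simp: charge_def)
        moreover from this have "(exp t powi charge S i - 1 / exp t powi charge S i) / ?d = - 1"
          using \<open>?d \<noteq> 0\<close> by (simp add: power_int_minus field_simps)
        ultimately show ?thesis
          using movable_flip_opposite(1)[OF 1] 1
          by (simp add: act spectral_flip vscale_uminus mult.commute del: movable.simps)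
      next
        case 2
        then have "charge S i = 1" "\<not> movable Plus i S"
          by (auto simp: charge_def)
        moreover from this have "(exp t powi charge S i - 1 / exp t powi charge S i) / ?d = 1"
          using \<open>?d \<noteq> 0\<close> by simp
        ultimately show ?thesis
          using movable_flip_opposite(2)[OF 2] 2
          by (simp add: act spectral_flip mult.commute del: movable.simps)
      next
        case 3
        then have "charge S i = 0"
          by (auto simp: charge_def)
        with 3 show ?thesis
          by (simp add: act del: movable.simps)
      qed
      with phi_part True show ?thesis
        by (simp only: xp_xm falg_action_minus if_True) simp
    next
      case False
      have far: "\<bar>i - j\<bar> \<ge> 2" if "movable Minus j S" "movable Plus i (flip j S)"
        using that movable_opposite_flip[OF False] by blast
      show ?thesis
        using False movable_opposite_flip(1)[OF False, of S] far
        by (auto simp: xp_xm act flip_commute spectral_flip mult.commute simp del: movable.simps)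
    qed
  next
    case (x_x c s i j m n)
    let ?u = "spectral t l a i" and ?w = "spectral t l a j"
      and ?q = "exp t powi (sgn_int s * Cartan i j)"
    consider "i = j" | "\<bar>i - j\<bar> \<ge> 2" | "\<bar>i - j\<bar> = 1"
      by linarith
    then show ?thesis
    proof cases
      case 1
      \<comment> \<open>Two equal moves in succession give 0, so all terms vanish.\<close>
      then show ?thesis
        using not_movable_flip_same[of s i S] by (auto simp: x_x act)
    next
      case 2
      then have "?q = 1"
        by (auto simp: Cartan_def)
      with 2 show ?thesis
        by (auto simp: x_x act movable_flip_far flip_commute spectral_flip mult.commute)
    next
      case 3
      \<comment> \<open>For neighbouring indices each side of the relation vanishes by
        itself.\<close>
      have "falg_action t l a
          (x_gen s i m * x_gen s j (n - 1) - cst ?q * x_gen s i (m - 1) * x_gen s j n) (bvec S) = 0"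
      proof (cases "movable s j S \<and> movable s i (flip j S)")
        case True
        with 3 S have "?q * ?w S = ?u (flip j S)"
          using spectral_adjacent[of S s j i t l a] by (simp add: Cartan_def power_int_minus)
        then have "?u (flip j S) powi m * ?w S powi (n - 1) -
            ?q * (?u (flip j S) powi (m - 1) * ?w S powi n) = 0"
          using power_int_pred[OF nz[of i "flip j S"], of m] power_int_pred[OF nz[of j S], of n]
          by simp
        with True show ?thesis
          by (simp add: act mult_ac flip: vscale_diff_left)
      next
        case False
        then show ?thesis
          by (auto simp: act)
      qed
      moreover have "falg_action t l a
          (cst ?q * x_gen s j (n - 1) * x_gen s i m - x_gen s j n * x_gen s i (m - 1)) (bvec S) = 0"
      proof (cases "movable s i S \<and> movable s j (flip i S)")
        case True
        with 3 S have "?q * ?u S = ?w (flip i S)"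
          using spectral_adjacent[of S s i j t l a]
          by (simp add: Cartan_def power_int_minus abs_minus_commute)
        then have "?q * (?w (flip i S) powi (n - 1) * ?u S powi m) -
            ?w (flip i S) powi n * ?u S powi (m - 1) = 0"
          using power_int_pred[OF nz[of j "flip i S"], of n] power_int_pred[OF nz[of i S], of m]
          by simp
        with True show ?thesis
          by (simp add: act mult_ac flip: vscale_diff_left)
      next
        case False
        then show ?thesis
          by (auto simp: act)
      qed
      ultimately show ?thesis
        by (simp only: x_x falg_action_minus[of _ _ _ "_ - _" "_ - _"]) simp
    qed
  next
    case (serre i j T s n m1 m2)
    then show ?thesis
      using not_movable_serre[of i j s S] not_movable_flip_same
      by (auto simp: act)
  next
    case (x_commute i j s m n)
    then show ?thesis
      by (auto simp: act movable_flip_far flip_commute spectral_flip mult.commute)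
  qed
qed

section \<open>The module structure\<close>

definition vspace :: "nat \<Rightarrow> vect set" where
  "vspace l = {v. Poly_Mapping.keys v \<subseteq> tableaux l}"

lemma vspace_closed:
  "0 \<in> vspace l"
  "v \<in> vspace l \<Longrightarrow> w \<in> vspace l \<Longrightarrow> v + w \<in> vspace l"
  "v \<in> vspace l \<Longrightarrow> vscale c v \<in> vspace l"
  using Poly_Mapping.keys_add[of v w] keys_vscale_subset[of c v] by (auto simp: vspace_def)

lemma vspace_sum: "(\<And>x. x \<in> A \<Longrightarrow> f x \<in> vspace l) \<Longrightarrow> sum f A \<in> vspace l"
  by (induction A rule: infinite_finite_induct) (auto intro: vspace_closed)

lemma vspace_uminus: "v \<in> vspace l \<Longrightarrow> - v \<in> vspace l"
  by (auto simp: vspace_def in_keys_iff)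

lemma bvec_in_vspace: "finite S \<Longrightarrow> card S = l \<Longrightarrow> bvec S \<in> vspace l"
  by (auto simp: vspace_def bvec_def tableaux_eq_image)

lemma vspace_induct [consumes 1, case_names basis scale add zero]:
  assumes "v \<in> vspace l"
    and "\<And>S. finite S \<Longrightarrow> card S = l \<Longrightarrow> P (bvec S)"
    and "\<And>c v. P v \<Longrightarrow> P (vscale c v)"
    and "\<And>v w. P v \<Longrightarrow> P w \<Longrightarrow> P (v + w)"
    and "P 0"
  shows "P v"
proof -
  have "P (\<Sum>T\<in>A. vscale (Poly_Mapping.lookup v T) (basis_vec T))"
    if "finite A" "A \<subseteq> tableaux l" for A
    using that
    by (induction A rule: finite_induct) (auto simp: tableaux_eq_image bvec_def[symmetric]
        intro!: assms(2-))
  from this[of "Poly_Mapping.keys v"] show ?thesis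
    using assms(1) basis_expansion[of v] by (simp add: vspace_def)
qed

lemma gen_action_in_vspace:
  assumes "v \<in> vspace l"
  shows "lin_ext (gen_action t l a g) v \<in> vspace l"
  using assms
proof (induction rule: vspace_induct)
  case (basis S)
  then show ?case
  proof (cases g)
    case (GenX s i r)
    with basis show ?thesis
      using gen_action_x[of S l t a s i r]
      by (auto simp: bvec_def[of S] intro!: vspace_closed bvec_in_vspace)
  qed (auto simp: bvec_def intro!: vspace_closed bvec_in_vspace[unfolded bvec_def])
qed (auto simp: lin_ext_add lin_ext_vscale intro: vspace_closed)

lemma falg_action_in_vspace:
  assumes "v \<in> vspace l"
  shows "falg_action t l a f v \<in> vspace l"
proof -
  have "foldr (\<lambda>g. lin_ext (gen_action t l a g)) gs v \<in> vspace l" for gs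
    by (induction gs) (auto intro: assms gen_action_in_vspace)
  then show ?thesis
    unfolding falg_action_def by (intro vspace_sum vspace_closed)
qed

section \<open>The quotient algebra and its action\<close>

lemma free_ring_simps [simp]:
  "carrier (free_ring :: falg ring) = UNIV"
  "f \<oplus>\<^bsub>free_ring\<^esub> g = f + g" "f \<otimes>\<^bsub>free_ring\<^esub> g = f * g"
  "\<zero>\<^bsub>free_ring\<^esub> = (0 :: falg)" "\<one>\<^bsub>free_ring\<^esub> = (1 :: falg)"
  for f g :: falg
  by (simp_all add: ring_of_type_algebra_def)

lemma ring_free_ring: "ring (free_ring :: falg ring)"
proof -
  have "\<exists>g. f + g = 0" for f :: falg
    using add.right_inverse by blast
  then show ?thesis
    by unfold_locales (auto simp: algebra_simps Units_def)
qed

lemma free_ring_a_inv: "inv\<^bsub>add_monoid free_ring\<^esub> f = - (f :: falg)"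
proof -
  interpret ring "free_ring :: falg ring"
    by (rule ring_free_ring)
  have "\<ominus>\<^bsub>free_ring\<^esub> f = - f"
    by (rule minus_equality) simp_all
  then show ?thesis
    by (simp add: a_inv_def)
qed

text \<open>The elements acting by 0 on \<open>vspace l\<close> form a two-sided ideal containing
  the relations. Closure under right multiplication uses that the action preserves
  \<open>vspace l\<close>.\<close>

lemma uq_ideal_annihilates:
  assumes "a \<noteq> 0" "(exp t)\<^sup>2 \<noteq> 1" "f \<in> uq_ideal t" "v \<in> vspace l"
  shows "falg_action t l a f v = 0"
proof -
  let ?I = "{f. \<forall>v\<in>vspace l. falg_action t l a f v = 0}"
  have "ideal ?I free_ring"
  proof (rule idealI[OF ring_free_ring])
    show "subgroup ?I (add_monoid free_ring)"
      by (rule subgroup.intro)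
        (auto simp: falg_action_plus free_ring_a_inv[simplified] falg_action_uminus)
  qed (auto simp: falg_action_times falg_action_linear falg_action_in_vspace)
  moreover have "uq_relations t \<subseteq> ?I"
  proof safe
    fix f v assume "f \<in> uq_relations t" "v \<in> vspace l"
    from this(2) show "falg_action t l a f v = 0"
      by (induction rule: vspace_induct)
        (use relation_annihilates \<open>f \<in> uq_relations t\<close> assms in \<open>auto simp: falg_action_linear\<close>)
  qed
  ultimately have "uq_ideal t \<subseteq> ?I"
    unfolding uq_ideal_def by (rule ring.genideal_minimal[OF ring_free_ring])
  with assms show ?thesis
    by blast
qed

lemma ideal_uq_ideal: "ideal (uq_ideal t) free_ring"
  unfolding uq_ideal_def by (rule ring.genideal_ideal[OF ring_free_ring]) simp

lemma uq_class_hom: "uq_class t \<in> ring_hom free_ring (Uq t)"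
  using ideal.rcos_ring_hom[OF ideal_uq_ideal] unfolding uq_class_def[abs_def] Uq_def .

lemma Uq_carrier: "carrier (Uq t) = range (uq_class t)"
  by (auto simp: Uq_def FactRing_def A_RCOSETS_def' uq_class_def)

lemma Uq_ops:
  "uq_class t f \<oplus>\<^bsub>Uq t\<^esub> uq_class t g = uq_class t (f + g)"
  "uq_class t f \<otimes>\<^bsub>Uq t\<^esub> uq_class t g = uq_class t (f * g)"
  "\<one>\<^bsub>Uq t\<^esub> = uq_class t 1"
  using ring_hom_add[OF uq_class_hom, of f g t] ring_hom_mult[OF uq_class_hom, of f g t]
    ring_hom_one[OF uq_class_hom, of t]
  by simp_all

lemma ring_Uq: "ring (Uq t)"
  unfolding Uq_def by (rule ideal.quotient_is_ring[OF ideal_uq_ideal])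

lemma V_simps [simp]:
  "carrier (V t l a) = vspace l" "\<zero>\<^bsub>V t l a\<^esub> = 0" "v \<oplus>\<^bsub>V t l a\<^esub> w = v + w"
  by (simp_all add: V_def vspace_def)

text \<open>Representatives of a class differ by an element of the ideal, which acts by 0. Hence the
  set in the definition of \<open>V\<close> is a singleton, and \<open>the_elem\<close> picks its
  member.\<close>

lemma smult_uq_class:
  assumes "a \<noteq> 0" "(exp t)\<^sup>2 \<noteq> 1" "v \<in> vspace l"
  shows "uq_class t f \<odot>\<^bsub>V t l a\<^esub> v = falg_action t l a f v"
proof -
  have "falg_action t l a g v = falg_action t l a f v" if "g \<in> uq_class t f" for g
  proof -
    from that obtain h where "h \<in> uq_ideal t" "g = h + f"
      by (auto simp: uq_class_def a_r_coset_def')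
    then show ?thesis
      using uq_ideal_annihilates[OF assms(1,2) _ assms(3)] by (simp add: falg_action_plus)
  qed
  moreover have "f \<in> uq_class t f"
    using ideal.axioms(1)[OF ideal_uq_ideal, THEN additive_subgroup.zero_closed]
    by (force simp: uq_class_def a_r_coset_def')
  ultimately have "(\<lambda>g. falg_action t l a g v) ` uq_class t f = {falg_action t l a f v}"
    by blast
  then show ?thesis
    by (simp add: V_def)
qed

lemma left_module_restrict:
  assumes "left_module R M" "ring (R\<lparr>carrier := A\<rparr>)" "A \<subseteq> carrier R"
  shows "left_module (R\<lparr>carrier := A\<rparr>) M"
proof -
  interpret left_module R M
    by fact
  show ?thesis
    using assms(2,3)
    by (intro left_module.intro left_module_axioms.intro abelian_group_axioms)
      (auto simp: subset_iff smult_closed smult_l_distr smult_r_distr smult_assoc smult_one)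
qed

lemma left_module_Uq:
  assumes "a \<noteq> 0" "(exp t)\<^sup>2 \<noteq> 1"
  shows "left_module (Uq t) (V t l a)"
proof (intro left_module.intro left_module_axioms.intro ring_Uq)
  show "abelian_group (V t l a)"
  proof (rule abelian_groupI)
    fix v assume "v \<in> carrier (V t l a)"
    then show "\<exists>w\<in>carrier (V t l a). w \<oplus>\<^bsub>V t l a\<^esub> v = \<zero>\<^bsub>V t l a\<^esub>"
      by (intro bexI[of _ "- v"]) (auto intro: vspace_uminus)
  qed (auto simp: algebra_simps intro: vspace_closed)
qed (auto simp: Uq_carrier Uq_ops smult_uq_class[OF assms] falg_action_simps
    falg_action_in_vspace vspace_closed)

lemma Uqh_generators:
  "range (\<lambda>c. uq_class t (cst c)) \<union> range (\<lambda>(s, i). uq_class t (x_gen s i 0))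
    \<union> range (\<lambda>h. uq_class t (k_gen h)) \<subseteq> carrier (Uq t)"
  by (auto simp: Uq_carrier)

lemma Uqh_carrier_subset: "carrier (Uqh t) \<subseteq> carrier (Uq t)"
  using ring.generate_ring_incl[OF ring_Uq Uqh_generators] by (simp add: Uqh_def)

lemma left_module_Uqh:
  assumes "a \<noteq> 0" "(exp t)\<^sup>2 \<noteq> 1"
  shows "left_module (Uqh t) (V t l a)"
  unfolding Uqh_def
  by (intro left_module_restrict left_module_Uq assms ring.generate_ring_is_ring[OF ring_Uq]
      ring.generate_ring_incl[OF ring_Uq] Uqh_generators)

section \<open>Irreducibility\<close>

text \<open>Moves to the right bring every tableau with entries at most \<open>B\<close> to the
  rightmost one.\<close>

lemma movable_connected_interval:
  assumes "finite S" "S \<subseteq> {..B}"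
    and step: "\<And>S s i. finite S \<Longrightarrow> card S = l \<Longrightarrow> movable s i S \<Longrightarrow> P S \<Longrightarrow> P (flip i S)"
    and "card S = l"
  shows "P S \<longleftrightarrow> P {B - int l + 1..B}"
  using assms(1,2,4)
\<comment> \<open>The measure is the total distance of the entries to \<open>B\<close>; a move to
  the right lowers it.\<close>
proof (induction "\<Sum>x\<in>S. nat (B - x)" arbitrary: S rule: less_induct)
  case less
  show ?case
  proof (cases "\<exists>i\<in>S. i + 1 \<notin> S \<and> i + 1 \<le> B")
    case True
    then obtain i where i: "i \<in> S" "i + 1 \<notin> S" "i + 1 \<le> B"
      by blast
    have flip: "flip i S = insert (i + 1) (S - {i})"
      using i by (auto simp: mem_flip split: if_splits)
    have "(\<Sum>x\<in>flip i S. nat (B - x)) = nat (B - (i + 1)) + (\<Sum>x\<in>S - {i}. nat (B - x))"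
      unfolding flip using less.prems i by (subst sum.insert) auto
    also have "\<dots> < nat (B - i) + (\<Sum>x\<in>S - {i}. nat (B - x))"
      using i by simp
    also have "\<dots> = (\<Sum>x\<in>S. nat (B - x))"
      using less.prems i by (simp add: sum.remove)
    finally have "P (flip i S) \<longleftrightarrow> P {B - int l + 1..B}"
    proof (rule less.hyps)
      show "flip i S \<subseteq> {..B}"
        using less.prems(2) i by (auto simp: flip)
    qed (simp_all add: less.prems)
    \<comment> \<open>The move of opposite sign leads back, so preservation of \<open>P\<close> is
      an equivalence.\<close>
    moreover have "P S \<longleftrightarrow> P (flip i S)"
    proof
      show "P S \<Longrightarrow> P (flip i S)"
        using less.prems i by (intro step[where s = Minus]) auto
      show "P (flip i S) \<Longrightarrow> P S"
        using step[of "flip i S" Plus i] less.prems i by (auto simp: mem_flip)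
    qed
    ultimately show ?thesis
      by simp
  next
    case False
    \<comment> \<open>With no move left, \<open>S\<close> is closed under successors up to
      \<open>B\<close>, hence an interval ending at \<open>B\<close>; its cardinality fixes the left
      end.\<close>
    have "S = {B - int l + 1..B}"
    proof (cases "S = {}")
      case True
      with less.prems show ?thesis
        by auto
    next
      case False
      define m where "m = Min S"
      have m: "m \<in> S" "\<And>x. x \<in> S \<Longrightarrow> m \<le> x"
        using less.prems(1) False by (auto simp: m_def)
      have "x \<in> S" if "m \<le> x" "x \<le> B" for x
        using that
      proof (induction x rule: int_ge_induct)
        case (step x)
        then show ?case
          using \<open>\<not> (\<exists>i\<in>S. i + 1 \<notin> S \<and> i + 1 \<le> B)\<close> by auto
      qed (use m in simp)
      with m less.prems(2) have S: "S = {m..B}"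
        by auto
      with less.prems(3) m(1) have "m = B - int l + 1"
        by auto
      with S show ?thesis
        by simp
    qed
    then show ?thesis
      by simp
  qed
qed

lemma movable_connected:
  assumes "finite S" "card S = l" "finite S'" "card S' = l"
    and step: "\<And>S s i. finite S \<Longrightarrow> card S = l \<Longrightarrow> movable s i S \<Longrightarrow> P S \<Longrightarrow> P (flip i S)"
    and "P S"
  shows "P S'"
proof -
  define B where "B = Max (insert 0 (S \<union> S'))"
  have "S \<subseteq> {..B}" "S' \<subseteq> {..B}"
    using assms(1,3) by (auto simp: B_def)
  then show ?thesis
    using movable_connected_interval[of S B l P] movable_connected_interval[of S' B l P] assms
    by blast
qed

text \<open>Above both sets there are no entries. From there downward, membership of
  \<open>x\<close> is determined by the charge at \<open>x\<close> and membership of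
  \<open>x + 1\<close>.\<close>

lemma charge_inject:
  assumes "finite S" "finite S'" "\<And>i. charge S i = charge S' i"
  shows "S = S'"
proof -
  define b where "b = Max (insert 0 (S \<union> S'))"
  have above: "x \<notin> S" "x \<notin> S'" if "x > b" for x
    using that assms(1,2) Max_ge[of "insert 0 (S \<union> S')" x] by (auto simp: b_def)
  have step: "x \<in> S \<longleftrightarrow> x \<in> S'" if "x + 1 \<in> S \<longleftrightarrow> x + 1 \<in> S'" for x
    using assms(3)[of x] that by (auto simp: charge_def of_bool_def split: if_splits)
  have "x \<in> S \<longleftrightarrow> x \<in> S'" if "x \<le> b + 1" for x
    using that
  proof (induction x rule: int_le_induct)
    case base
    then show ?case
      using above by simp
  next
    case (step x)
    then show ?case
      using \<open>\<And>x. (x + 1 \<in> S \<longleftrightarrow> x + 1 \<in> S') \<Longrightarrow> (x \<in> S \<longleftrightarrow> x \<in> S')\<close>[of "x - 1"] by simp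
  qed
  then show ?thesis
    using above by (auto simp: set_eq_iff) (metis not_less zless_add1_eq order.strict_iff_order)+
qed

lemma power_int_inject_not_root:
  fixes q :: "'a :: field"
  assumes "\<And>n :: nat. n \<ge> 1 \<Longrightarrow> q ^ n \<noteq> 1" "q \<noteq> 0" "q powi m = q powi n"
  shows "m = n"
proof -
  have "m \<le> n" if "q powi m = q powi n" for m n
  proof (rule ccontr)
    assume "\<not> m \<le> n"
    moreover have "q powi (m - n) = 1"
      using that assms(2) by (simp add: power_int_diff)
    ultimately show False
      using assms(1)[of "nat (m - n)"] by (auto simp: power_int_def)
  qed
  with assms(3) show ?thesis
    by (simp add: order_antisym)
qed

lemma lookup_falg_action_k:
  "Poly_Mapping.lookup (falg_action t l a (k_gen h) v) T =
    qpow t (weight T h) * Poly_Mapping.lookup v T"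
  by (cases "T \<in> Poly_Mapping.keys v")
    (auto simp: falg_action_gen lin_ext_def lookup_sum lookup_basis_vec in_keys_iff)

lemma weight_eq_set_weight: "finite S \<Longrightarrow> weight (sorted_list_of_set S) h = set_weight S h"
  by (simp add: weight_def set_weight_def charge_def)

lemma submodule_Uqh:
  assumes N: "submodule N (Uqh t) (V t l a)"
    and a: "a \<noteq> 0" and q: "\<And>n :: nat. n \<ge> 1 \<Longrightarrow> exp t ^ n \<noteq> 1"
  shows "N = {0} \<or> N = vspace l"
proof -
  have q2: "(exp t)\<^sup>2 \<noteq> 1"
    using q[of 2] by simp
  interpret submodule N "Uqh t" "V t l a"
    by fact
  \<comment> \<open>A \<open>submodule\<close> is a subgroup of the additive group in multiplicative
    notation, so \<open>one_closed\<close> and \<open>m_closed\<close> speak of zero and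
    sums.\<close>
  have sub: "N \<subseteq> vspace l" and zero: "0 \<in> N"
    and add: "\<And>v w. v \<in> N \<Longrightarrow> w \<in> N \<Longrightarrow> v + w \<in> N"
    using subset one_closed m_closed by auto
  have gen: "falg_action t l a f v \<in> N"
    if "f \<in> range cst \<union> range (\<lambda>(s, i). x_gen s i 0) \<union> range k_gen" "v \<in> N" for f v
  proof -
    have "uq_class t f \<in> carrier (Uqh t)"
      using that(1) by (auto simp: Uqh_def intro!: generate_ring.incl)
    from smult_closed[OF this that(2)] show ?thesis
      using smult_uq_class[OF a q2] sub that(2) by auto
  qed
  have scale: "vscale c v \<in> N" if "v \<in> N" for c v
    using gen[of "cst c" v] that by simp
  show ?thesis
  proof (cases "N = {0}")
    case False
    then obtain u where u: "u \<in> N \<and> u \<noteq> 0"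
      using zero by blast
    obtain v where v: "v \<in> N" "v \<noteq> 0"
      and min: "\<And>w. w \<in> N \<Longrightarrow> w \<noteq> 0 \<Longrightarrow> card (Poly_Mapping.keys v) \<le> card (Poly_Mapping.keys w)"
      using ex_has_least_nat[of "\<lambda>v. v \<in> N \<and> v \<noteq> 0", OF u, of "\<lambda>v. card (Poly_Mapping.keys v)"]
      by blast
    from v(2) obtain T where T: "T \<in> Poly_Mapping.keys v"
      by (metis in_keys_iff lookup_zero poly_mapping_eqI)
    have "v \<in> vspace l"
      using v sub by blast
    then have keys_tableaux: "Poly_Mapping.keys v \<subseteq> sorted_list_of_set ` {S. finite S \<and> card S = l}"
      by (simp add: vspace_def tableaux_eq_image)
    with T obtain S where S: "T = sorted_list_of_set S" "finite S" "card S = l"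
      by blast
    have "T' = T" if T': "T' \<in> Poly_Mapping.keys v" for T'
    proof (rule ccontr)
      assume "T' \<noteq> T"
      from T' keys_tableaux obtain S' where S': "T' = sorted_list_of_set S'" "finite S'"
        by blast
      with S \<open>T' \<noteq> T\<close> obtain i where i: "charge S i \<noteq> charge S' i"
        using charge_inject by blast
      define h :: "int \<Rightarrow>\<^sub>0 rat" where "h = Poly_Mapping.single i 1"
      \<comment> \<open>The coefficient at \<open>T\<close> cancels, while the one at
        \<open>T'\<close> is multiplied by a difference of two distinct powers of q. So
        \<open>w\<close> contradicts the minimality of the support of \<open>v\<close>.\<close>
      define w where "w = falg_action t l a (k_gen h) v + vscale (- qpow t (weight T h)) v"
      have weights: "qpow t (weight T h) = exp t powi charge S i"
        "qpow t (weight T' h) = exp t powi charge S' i"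
        using S S' by (simp_all add: weight_eq_set_weight h_def set_weight_single qpow_of_int)
      have lookup_w: "Poly_Mapping.lookup w U =
          (qpow t (weight U h) - qpow t (weight T h)) * Poly_Mapping.lookup v U" for U
        by (simp add: w_def lookup_add lookup_falg_action_k algebra_simps)
      have "w \<in> N"
        unfolding w_def using v by (intro add scale gen) auto
      moreover have "exp t powi charge S' i \<noteq> exp t powi charge S i"
        using power_int_inject_not_root[OF q, of "charge S' i" "charge S i"] i by auto
      then have "Poly_Mapping.lookup w T' \<noteq> 0"
        using T' by (simp add: lookup_w weights in_keys_iff)
      then have "w \<noteq> 0"
        by auto
      moreover have "Poly_Mapping.keys w \<subset> Poly_Mapping.keys v"
        using T by (auto simp: in_keys_iff lookup_w)
      then have "card (Poly_Mapping.keys w) < card (Poly_Mapping.keys v)"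
        by (intro psubset_card_mono) auto
      ultimately show False
        using min by fastforce
    qed
    with T have keys_v: "Poly_Mapping.keys v = {T}"
      by blast
    then have "v = vscale (Poly_Mapping.lookup v T) (bvec S)"
      using basis_expansion[of v] S by (simp add: bvec_def)
    moreover have "Poly_Mapping.lookup v T \<noteq> 0"
      using T by (simp add: in_keys_iff)
    ultimately have bvec_S: "bvec S \<in> N"
      using scale[OF v(1), of "1 / Poly_Mapping.lookup v T"]
      by (metis nonzero_eq_divide_eq vscale_simps(3) vscale_vscale)
    have "bvec S' \<in> N" if "finite S'" "card S' = l" for S'
    proof (rule movable_connected[OF S(2,3) that, where P = "\<lambda>S. bvec S \<in> N"])
      fix S s i
      assume "finite S" "card S = l" "movable s i S" "bvec S \<in> N"
      moreover have "x_gen s i 0 \<in> range (\<lambda>(s, i). x_gen s i 0)"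
        by (rule range_eqI[of _ _ "(s, i)"]) simp
      \<comment> \<open>In mode 0 the power of the spectral parameter is 1, so the result is exactly
        the neighbouring basis vector.\<close>
      ultimately show "bvec (flip i S) \<in> N"
        using gen[of "x_gen s i 0" "bvec S"] by (simp add: falg_action_x)
    qed (rule bvec_S)
    then have "vspace l \<subseteq> N"
      by (auto elim!: vspace_induct intro: scale add zero)
    with sub show ?thesis
      by blast
  qed simp
qed

theorem proposition3p12:
  fixes t a :: complex and l :: nat
  assumes "\<And>n :: nat. n \<ge> 1 \<Longrightarrow> exp t ^ n \<noteq> 1"
    and "l \<ge> 1"
    and "a \<noteq> 0"
  shows "irreducible_module (Uq t) (V t l a) \<and> irreducible_module (Uqh t) (V t l a)"
proof -
  have q2: "(exp t)\<^sup>2 \<noteq> 1"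
    using assms(1)[of 2] by simp
  have "bvec {1..int l} \<in> vspace l" "bvec {1..int l} \<noteq> 0"
    by (auto simp: bvec_in_vspace) (metis bvec_def keys_basis_vec keys_zero insert_not_empty)
  then have nontrivial: "vspace l \<noteq> {0}"
    by blast
  \<comment> \<open>Restricting scalars can only enlarge the set of submodules, so the horizontal
    subalgebra decides both claims.\<close>
  have "submodule N (Uqh t) (V t l a)" if "submodule N (Uq t) (V t l a)" for N
    using that Uqh_carrier_subset
    by (auto simp: submodule_def submodule_axioms_def)
  then show ?thesis
    using submodule_Uqh[OF _ assms(3,1)] nontrivial
      left_module_Uq[OF assms(3) q2] left_module_Uqh[OF assms(3) q2]
    by (auto simp: irreducible_module_def)
qed

end
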